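(* Let $f(r)=r$ and $q_0=(x_0,y_0,z_0)$ with $r_0=\sqrt{x_0^2+y_0^2}>0$. Let $\gamma$ be a unit-speed normal trajectory from $q_0$ with initial covector $\lambda_0=(u_0,v_0,w_0)$ satisfying $K=x_0v_0-y_0u_0>0$, $w_0>0$ and $L=x_0u_0+y_0v_0>0$. Write $\gamma$ in cylindrical coordinates as $(r(t),\theta(t),z(t))$. Then $r(t)$ oscillates between values $0<r_{\min}<r_0<r_{\max}$ determined by $$w_0=\frac1{\sqrt{r_{\min}^2+r_{\max}^2}},\qquad K=\frac{r_{\min}r_{\max}}{\sqrt{r_{\min}^2+r_{\max}^2}}.$$ The map $(r_{\min},r_{\max})\in(0,r_0)\times(r_0,\infty)$ is a coordinate chart on the part of $E_1$ where $K,L,w_0>0$. In these coordinates, with $s=w_0t+\phi$, $$r(t)^2=r_{\min}^2+(r_{\max}^2-r_{\min}^2)\sin^2 s,$$ where $\phi\in(0,\pi/2)$ is defined by $r_0^2=r_{\min}^2+(r_{\max}^2-r_{\min}^2)\sin^2\phi$. The Jacobian $D(t,r_{\min},r_{\max}):=\dfrac{\partial(r,\theta)}{\partial(r_{\min},r_{\max})}=r_{r_{\min}}\theta_{r_{\max}}-r_{r_{\max}}\theta_{r_{\min}}$ equals $$D=\frac1{r(t)}\Big[w_0^3t\big((\cot\phi\,r_{\max}^2-\tan\phi\,r_{\min}^2)\sin s\cos s+r_{\min}^2\sin^2s-r_{\max}^2\cos^2s\big)+2\sin s\cos s-\tan\phi\cos^2s-\cot\phi\sin^2s\Big].$$ Its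 first positive zero in $t$ is exactly $t=\pi/w_0$, and $t_{\mathrm{con}}(\gamma)=\pi/w_0$.
   Context: Consider $\mathbb R^3$ with points $q=(x,y,z)$, $r=\sqrt{x^2+y^2}$, and the function $f(r)=r$. Normal trajectories are projections of solutions of $$\dot x=u,\quad \dot y=v,\quad \dot z=r^2w,\quad \dot u=-w^2x,\quad \dot v=-w^2y,\quad \dot w=0,$$ with initial covector $\lambda_0=(u_0,v_0,w_0)$. They are unit speed when $\lambda_0\in E_1=\{u_0^2+v_0^2+r_0^2w_0^2=1\}$. Exponential map and conjugate time: - $\mathrm{Exp}_{q_0}(\lambda_0)=\gamma(1;\lambda_0)$. - $t_{\mathrm{con}}(\gamma)=\inf\{t>0:\mathrm{Exp}_{q_0}\text{ has a critical point at }t\lambda_0\}$. *)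

theory Defs
  imports "HOL-Analysis.Analysis"
begin

definition cyl_r :: "real * real * real \<Rightarrow> real" where
  "cyl_r q = (case q of (x, y, z) \<Rightarrow> sqrt (x^2 + y^2))"

definition normal_lift ::
  "real * real * real \<Rightarrow> real * real * real \<Rightarrow> (real \<Rightarrow> real * real * real)
   \<Rightarrow> (real \<Rightarrow> real * real * real) \<Rightarrow> bool" where
  "normal_lift q0 l0 q l \<longleftrightarrow> q 0 = q0 \<and> l 0 = l0 \<and>
     (\<forall>t. (q has_vector_derivative
              (case q t of (x, y, z) \<Rightarrow> case l t of (u, v, w) \<Rightarrow> (u, v, (x^2 + y^2) * w))) (at t)
        \<and> (l has_vector_derivative
              (case q t of (x, y, z) \<Rightarrow> case l t of (u, v, w) \<Rightarrow> (- (w^2) * x, - (w^2) * y, 0))) (at t))"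

definition normal_traj :: "real * real * real \<Rightarrow> real * real * real \<Rightarrow> real \<Rightarrow> real * real * real" where
  "normal_traj q0 l0 = (THE q. \<exists>l. normal_lift q0 l0 q l)"

definition Exp :: "real * real * real \<Rightarrow> real * real * real \<Rightarrow> real * real * real" where
  "Exp q0 l0 = normal_traj q0 l0 1"

definition exp_critical :: "real * real * real \<Rightarrow> real * real * real \<Rightarrow> bool" where
  "exp_critical q0 p \<longleftrightarrow> (\<exists>L. (Exp q0 has_derivative L) (at p) \<and> \<not> surj L)"

definition t_con :: "real * real * real \<Rightarrow> real * real * real \<Rightarrow> real" where
  "t_con q0 l0 = Inf {t. t > 0 \<and> exp_critical q0 (t *\<^sub>R l0)}"

definition E1 :: "real * real * real \<Rightarrow> (real * real * real) set" where
  "E1 q0 = {l. case l of (u, v, w) \<Rightarrow> u^2 + v^2 + (cyl_r q0)^2 * w^2 = 1}"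

definition Kof :: "real * real * real \<Rightarrow> real * real * real \<Rightarrow> real" where
  "Kof q0 l = (case q0 of (x0, y0, z0) \<Rightarrow> case l of (u0, v0, w0) \<Rightarrow> x0 * v0 - y0 * u0)"

definition Lof :: "real * real * real \<Rightarrow> real * real * real \<Rightarrow> real" where
  "Lof q0 l = (case q0 of (x0, y0, z0) \<Rightarrow> case l of (u0, v0, w0) \<Rightarrow> x0 * u0 + y0 * v0)"

definition wof :: "real * real * real \<Rightarrow> real" where
  "wof l = snd (snd l)"

definition rmin :: "real * real * real \<Rightarrow> real * real * real \<Rightarrow> real" where
  "rmin q0 l0 = Inf (range (\<lambda>t. cyl_r (normal_traj q0 l0 t)))"

definition rmax :: "real * real * real \<Rightarrow> real * real * real \<Rightarrow> real" where
  "rmax q0 l0 = Sup (range (\<lambda>t. cyl_r (normal_traj q0 l0 t)))"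

definition phase :: "real \<Rightarrow> real \<Rightarrow> real \<Rightarrow> real" where
  "phase r0 a b = (THE \<phi>. 0 < \<phi> \<and> \<phi> < pi / 2 \<and> r0^2 = a^2 + (b^2 - a^2) * (sin \<phi>)^2)"

definition Dexpr :: "real \<Rightarrow> real \<Rightarrow> real \<Rightarrow> real \<Rightarrow> real \<Rightarrow> real" where
  "Dexpr r0 a b t r =
     (let w0 = 1 / sqrt (a^2 + b^2); \<phi> = phase r0 a b; s = w0 * t + \<phi> in
      (1 / r) * (w0^3 * t * ((cot \<phi> * b^2 - tan \<phi> * a^2) * sin s * cos s
                              + a^2 * (sin s)^2 - b^2 * (cos s)^2)
                 + 2 * sin s * cos s - tan \<phi> * (cos s)^2 - cot \<phi> * (sin s)^2))"

definition angle_lift ::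
  "real * real * real \<Rightarrow> (real * real \<Rightarrow> real * real * real) \<Rightarrow> (real * real) set
   \<Rightarrow> (real \<Rightarrow> real \<Rightarrow> real \<Rightarrow> real) \<Rightarrow> bool" where
  "angle_lift q0 \<Psi> A \<Theta> \<longleftrightarrow>
     continuous_on (UNIV \<times> A) (\<lambda>(t, p). \<Theta> t (fst p) (snd p)) \<and>
     (\<forall>t. \<forall>p\<in>A. case normal_traj q0 (\<Psi> p) t of (x, y, z) \<Rightarrow>
          x = cyl_r (normal_traj q0 (\<Psi> p) t) * cos (\<Theta> t (fst p) (snd p)) \<and>
          y = cyl_r (normal_traj q0 (\<Psi> p) t) * sin (\<Theta> t (fst p) (snd p)))"

end

theory Submission
  imports Defs
begin

text \<open>
  For \<open>w \<noteq> 0\<close> the Hamiltonian system is a planar harmonic oscillator of frequency \<open>w\<close>: in complex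
  notation \<open>x + i y = (x0 + i y0) (cos (w t) + (L + i K) sin (w t) / (w r0\<^sup>2))\<close>. Parametrising the
  covector by \<open>a, b\<close> through \<open>w = (a\<^sup>2 + b\<^sup>2)\<^sup>-\<^sup>1\<^sup>/\<^sup>2\<close>, \<open>K = a b w\<close> and
  \<open>L = w ((r0\<^sup>2 - a\<^sup>2) (b\<^sup>2 - r0\<^sup>2))\<^sup>1\<^sup>/\<^sup>2\<close> gives \<open>r\<^sup>2 = a\<^sup>2 + (b\<^sup>2 - a\<^sup>2) sin\<^sup>2 (w t + \<phi>)\<close>, so
  \<open>a, b\<close> are the extreme radii, and the inverse of this parametrisation is explicit (\<open>a\<^sup>2, b\<^sup>2\<close> are
  the roots of a quadratic).

  Writing \<open>\<partial>(r, \<theta>)/\<partial>(a, b) = \<partial>(x, y)/\<partial>(a, b) / r\<close>, a direct computation gives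
  \<open>r D sin \<phi> cos \<phi> = sin x (x (k cos x - B sin x) - sin x)\<close> with \<open>x = w t\<close>, \<open>0 \<le> k < 1\<close>,
  \<open>B \<ge> 0\<close>; since \<open>x cos x < sin x\<close> on \<open>(0, \<pi>]\<close>, this is negative for \<open>0 < x < \<pi>\<close> and vanishes
  at \<open>x = \<pi>\<close>.

  For the conjugate time, the differential of \<open>Exp\<close> at \<open>t \<lambda>0\<close> has determinant
  \<open>sinc x ((r0\<^sup>2 + t L) sinc x + t\<^sup>2 (u0\<^sup>2 + v0\<^sup>2) (sin x - x cos x) / x\<^sup>3)\<close> with \<open>x = t w0\<close>, which
  is positive for \<open>0 < x < \<pi>\<close>; at \<open>x = \<pi>\<close> the vanishing of \<open>sinc x\<close> makes the first two
  rows of the differential proportional.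
\<close>

lemma has_vector_derivative_componentsD:
  assumes "(f has_vector_derivative (a, b, c)) (at t)"
  shows "((\<lambda>t. fst (f t)) has_real_derivative a) (at t)"
    and "((\<lambda>t. fst (snd (f t))) has_real_derivative b) (at t)"
    and "((\<lambda>t. snd (snd (f t))) has_real_derivative c) (at t)"
proof -
  have "((\<lambda>t. snd (f t)) has_vector_derivative (b, c)) (at t)"
    using bounded_linear.has_vector_derivative[OF bounded_linear_snd assms] by simp
  then show "((\<lambda>t. fst (f t)) has_real_derivative a) (at t)"
    and "((\<lambda>t. fst (snd (f t))) has_real_derivative b) (at t)"
    and "((\<lambda>t. snd (snd (f t))) has_real_derivative c) (at t)"
    using bounded_linear.has_vector_derivative[OF bounded_linear_fst assms]
      bounded_linear.has_vector_derivative[OF bounded_linear_fst]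
      bounded_linear.has_vector_derivative[OF bounded_linear_snd]
    by (fastforce simp: has_real_derivative_iff_has_vector_derivative)+
qed

text \<open>The energy \<open>w\<^sup>2 (x - X)\<^sup>2 + (p - P)\<^sup>2\<close> of the difference of two solutions is
  constant.\<close>
lemma harmonic_oscillator_unique:
  fixes x p X P :: "real \<Rightarrow> real"
  assumes "w \<noteq> 0"
    and "\<And>t. (x has_real_derivative p t) (at t)" "\<And>t. (p has_real_derivative - (w^2 * x t)) (at t)"
    and "\<And>t. (X has_real_derivative P t) (at t)" "\<And>t. (P has_real_derivative - (w^2 * X t)) (at t)"
    and "x 0 = X 0" "p 0 = P 0"
  shows "x t = X t"
proof -
  define E where "E t = w^2 * (x t - X t)^2 + (p t - P t)^2" for t
  have "(E has_real_derivative 0) (at t)" for t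
    unfolding E_def by (rule derivative_eq_intros refl assms(2-5))+ (simp add: algebra_simps)
  then have "E t = E 0"
    by (intro DERIV_isconst_all) auto
  also have "E 0 = 0"
    using assms(6,7) by (simp add: E_def)
  finally have "w^2 * (x t - X t)^2 = 0"
    unfolding E_def by (smt (verit) zero_le_power2 mult_nonneg_nonneg)
  with assms(1) show ?thesis
    by simp
qed

definition osc :: "real \<Rightarrow> real \<Rightarrow> real \<Rightarrow> real \<Rightarrow> real" where
  "osc p0 p w t = p0 * cos (w * t) + p * sin (w * t) / w"

definition osc_vel :: "real \<Rightarrow> real \<Rightarrow> real \<Rightarrow> real \<Rightarrow> real" where
  "osc_vel p0 p w t = p * cos (w * t) - p0 * w * sin (w * t)"

lemma osc_has_derivative:
  "w \<noteq> 0 \<Longrightarrow> (osc p0 p w has_real_derivative osc_vel p0 p w t) (at t)"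
  unfolding osc_def[abs_def] osc_vel_def
  by (auto intro!: derivative_eq_intros simp: field_simps)

lemma osc_vel_has_derivative:
  "w \<noteq> 0 \<Longrightarrow> (osc_vel p0 p w has_real_derivative - (w^2 * osc p0 p w t)) (at t)"
  unfolding osc_def osc_vel_def[abs_def]
  by (auto intro!: derivative_eq_intros simp: field_simps power2_eq_square)

definition root_lo :: "real \<Rightarrow> real \<Rightarrow> real" where
  "root_lo s p = sqrt ((s - sqrt (s^2 - 4 * p)) / 2)"

definition root_hi :: "real \<Rightarrow> real \<Rightarrow> real" where
  "root_hi s p = sqrt ((s + sqrt (s^2 - 4 * p)) / 2)"

lemma root_lo_hi:
  fixes s p :: real
  assumes "0 < p" "4 * p < s^2" "0 < s"
  shows "0 < root_lo s p" "root_lo s p < root_hi s p"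
    and "(root_lo s p)^2 + (root_hi s p)^2 = s" "root_lo s p * root_hi s p = sqrt p"
proof -
  define d where "d = sqrt (s^2 - 4 * p)"
  have d: "0 < d" "d^2 = s^2 - 4 * p"
    using assms by (simp_all add: d_def)
  then have "d < s"
    using assms by (smt (verit) power_mono)
  then have lo: "(root_lo s p)^2 = (s - d) / 2" and hi: "(root_hi s p)^2 = (s + d) / 2"
    using d by (simp_all add: root_lo_def root_hi_def d_def[symmetric])
  show "0 < root_lo s p"
    using \<open>d < s\<close> by (simp add: root_lo_def d_def[symmetric])
  moreover have "0 < root_hi s p"
    using d assms by (simp add: root_hi_def d_def[symmetric])
  moreover have "(root_lo s p)^2 < (root_hi s p)^2"
    using d lo hi by simp
  ultimately show "root_lo s p < root_hi s p"
    by (smt (verit) power_mono)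
  show "(root_lo s p)^2 + (root_hi s p)^2 = s"
    using lo hi by simp
  have "(root_lo s p * root_hi s p)^2 = p"
    unfolding power_mult_distrib lo hi using d by (simp add: field_simps power2_eq_square)
  with \<open>0 < root_lo s p\<close> \<open>0 < root_hi s p\<close> show "root_lo s p * root_hi s p = sqrt p"
    by (metis abs_of_pos mult_pos_pos real_sqrt_abs)
qed

lemma exists_nat_beyond:
  fixes w c T :: real
  assumes "0 < w"
  shows "\<exists>n::nat. T < (real n * pi + c) / w"
proof -
  obtain n :: nat where "(T * w - c) / pi < real n"
    using reals_Archimedean2 by blast
  then have "T * w < real n * pi + c"
    by (simp add: field_simps)
  with assms show ?thesis
    by (auto simp: pos_less_divide_eq)
qed

lemma has_derivative_partial_fst:
  fixes f :: "real \<times> real \<Rightarrow> real"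
  assumes "(f has_derivative f') (at (a, b))"
  shows "((\<lambda>x. f (x, b)) has_real_derivative f' (1, 0)) (at a)"
proof -
  have "((\<lambda>x. (x, b)) has_derivative (\<lambda>h. (h, 0))) (at a)"
    by (intro has_derivative_Pair has_derivative_ident has_derivative_const)
  from has_derivative_compose[OF this assms]
  have "((\<lambda>x. f (x, b)) has_derivative (\<lambda>h. f' (h, 0))) (at a)" .
  moreover have "(\<lambda>h. f' (h, 0)) = (*) (f' (1, 0))"
  proof
    fix h
    have "f' (h, 0) = f' (h *\<^sub>R (1, 0))"
      by simp
    also have "\<dots> = h *\<^sub>R f' (1, 0)"
      by (rule linear_scale[OF has_derivative_linear[OF assms]])
    finally show "f' (h, 0) = f' (1, 0) * h"
      by simp
  qed
  ultimately have "((\<lambda>x. f (x, b)) has_derivative (*) (f' (1, 0))) (at a)"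
    by (rule has_derivative_eq_rhs)
  then show ?thesis
    by (simp add: has_field_derivative_def)
qed

lemma has_derivative_partial_snd:
  fixes f :: "real \<times> real \<Rightarrow> real"
  assumes "(f has_derivative f') (at (a, b))"
  shows "((\<lambda>y. f (a, y)) has_real_derivative f' (0, 1)) (at b)"
proof -
  have "((\<lambda>y. (a, y)) has_derivative (\<lambda>h. (0, h))) (at b)"
    by (intro has_derivative_Pair has_derivative_ident has_derivative_const)
  from has_derivative_compose[OF this assms]
  have "((\<lambda>y. f (a, y)) has_derivative (\<lambda>h. f' (0, h))) (at b)" .
  moreover have "(\<lambda>h. f' (0, h)) = (*) (f' (0, 1))"
  proof
    fix h
    have "f' (0, h) = f' (h *\<^sub>R (0, 1))"
      by simp
    also have "\<dots> = h *\<^sub>R f' (0, 1)"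
      by (rule linear_scale[OF has_derivative_linear[OF assms]])
    finally show "f' (0, h) = f' (0, 1) * h"
      by simp
  qed
  ultimately have "((\<lambda>y. f (a, y)) has_derivative (*) (f' (0, 1))) (at b)"
    by (rule has_derivative_eq_rhs)
  then show ?thesis
    by (simp add: has_field_derivative_def)
qed

lemma has_real_derivative_sqrt_sum_squares:
  fixes X Y :: "real \<Rightarrow> real"
  assumes "(X has_real_derivative X') (at s)" "(Y has_real_derivative Y') (at s)"
    and "0 < (X s)^2 + (Y s)^2"
  shows "((\<lambda>u. sqrt ((X u)^2 + (Y u)^2)) has_real_derivative
    (X s * X' + Y s * Y') / sqrt ((X s)^2 + (Y s)^2)) (at s)"
proof -
  have "((\<lambda>u. (X u)^2 + (Y u)^2) has_real_derivative 2 * (X s * X' + Y s * Y')) (at s)"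
    using assms(1,2) by (auto intro!: derivative_eq_intros simp: algebra_simps)
  from DERIV_chain2[OF DERIV_real_sqrt[OF assms(3)] this]
  show ?thesis
    by (rule DERIV_cong) (cases "sqrt ((X s)^2 + (Y s)^2) = 0", simp_all add: field_simps)
qed

text \<open>A continuous angle stays within \<open>\<pi>/2\<close> of \<open>h s0\<close> near \<open>s0\<close>, where it is therefore
  \<open>h s0\<close> plus the arctangent of the ratio of the coordinates rotated by \<open>- h s0\<close>.\<close>
lemma continuous_angle_locally_arctan:
  fixes h X Y :: "real \<Rightarrow> real"
  assumes U: "open U" "s0 \<in> U" and h: "continuous_on U h"
    and polar: "\<And>s. s \<in> U \<Longrightarrow>
      X s = sqrt ((X s)^2 + (Y s)^2) * cos (h s) \<and> Y s = sqrt ((X s)^2 + (Y s)^2) * sin (h s)"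
    and nz: "\<And>s. s \<in> U \<Longrightarrow> 0 < (X s)^2 + (Y s)^2"
  obtains V where "open V" "s0 \<in> V"
    "\<And>u. u \<in> V \<Longrightarrow> h u = h s0 + arctan ((Y u * cos (h s0) - X u * sin (h s0))
      / (X u * cos (h s0) + Y u * sin (h s0)))"
proof -
  obtain d where d: "0 < d" "\<And>u. u \<in> U \<Longrightarrow> dist u s0 < d \<Longrightarrow> dist (h u) (h s0) < pi / 2"
    using h U(2) pi_half_gt_zero unfolding continuous_on_iff by blast
  have "h u = h s0 + arctan ((Y u * cos (h s0) - X u * sin (h s0)) / (X u * cos (h s0) + Y u * sin (h s0)))"
    if "u \<in> U \<inter> ball s0 d" for u
  proof -
    have "u \<in> U" "dist u s0 < d"
      using that by (simp_all add: dist_commute)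
    then have u: "u \<in> U" "\<bar>h u - h s0\<bar> < pi / 2"
      using d(2) by (auto simp: dist_real_def)
    define R where "R = sqrt ((X u)^2 + (Y u)^2)"
    have "X u * cos (h s0) + Y u * sin (h s0) = R * cos (h u - h s0)"
      "Y u * cos (h s0) - X u * sin (h s0) = R * sin (h u - h s0)"
      using polar[OF u(1)] unfolding R_def cos_diff sin_diff by (simp_all add: algebra_simps)
    moreover have "0 < cos (h u - h s0)" "0 < R"
      using nz[OF u(1)] u(2) unfolding abs_less_iff by (auto intro!: cos_gt_zero_pi simp: R_def)
    moreover have "arctan (tan (h u - h s0)) = h u - h s0"
      using u(2) unfolding abs_less_iff by (intro arctan_tan) linarith+
    ultimately show ?thesis
      by (simp add: tan_def)
  qed
  moreover have "open (U \<inter> ball s0 d)" "s0 \<in> U \<inter> ball s0 d"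
    using U d by auto
  ultimately show ?thesis
    using that by blast
qed

lemma continuous_angle_has_derivative:
  fixes h X Y :: "real \<Rightarrow> real"
  assumes U: "open U" "s0 \<in> U" and h: "continuous_on U h"
    and polar: "\<And>s. s \<in> U \<Longrightarrow>
      X s = sqrt ((X s)^2 + (Y s)^2) * cos (h s) \<and> Y s = sqrt ((X s)^2 + (Y s)^2) * sin (h s)"
    and nz: "\<And>s. s \<in> U \<Longrightarrow> 0 < (X s)^2 + (Y s)^2"
    and X: "(X has_real_derivative X') (at s0)" and Y: "(Y has_real_derivative Y') (at s0)"
  shows "(h has_real_derivative (X s0 * Y' - Y s0 * X') / ((X s0)^2 + (Y s0)^2)) (at s0)"
proof -
  obtain V where V: "open V" "s0 \<in> V"
    and h_eq: "\<And>u. u \<in> V \<Longrightarrow> h u = h s0 + arctan ((Y u * cos (h s0) - X u * sin (h s0))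
      / (X u * cos (h s0) + Y u * sin (h s0)))"
    using continuous_angle_locally_arctan[OF U h polar nz] by blast
  define c s R where "c = cos (h s0)" and "s = sin (h s0)" and "R = sqrt ((X s0)^2 + (Y s0)^2)"
  have R: "0 < R" "c^2 + s^2 = 1" "X s0 = R * c" "Y s0 = R * s" "(X s0)^2 + (Y s0)^2 = R^2"
    using polar[OF U(2)] nz[OF U(2)] by (simp_all add: c_def s_def R_def)
  then have R0: "X s0 * c + Y s0 * s = R" "Y s0 * c - X s0 * s = 0"
    by (simp_all add: algebra_simps flip: distrib_left power2_eq_square)
  have "((\<lambda>u. h s0 + arctan ((Y u * c - X u * s) / (X u * c + Y u * s))) has_real_derivative
      1 / (1 + ((Y s0 * c - X s0 * s) / (X s0 * c + Y s0 * s))^2)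
        * (((Y' * c - X' * s) * (X s0 * c + Y s0 * s) - (Y s0 * c - X s0 * s) * (X' * c + Y' * s))
          / ((X s0 * c + Y s0 * s) * (X s0 * c + Y s0 * s)))) (at s0)"
    using X Y R0 R(1) by (auto intro!: derivative_eq_intros simp: power2_eq_square)
  also have "1 / (1 + ((Y s0 * c - X s0 * s) / (X s0 * c + Y s0 * s))^2)
        * (((Y' * c - X' * s) * (X s0 * c + Y s0 * s) - (Y s0 * c - X s0 * s) * (X' * c + Y' * s))
          / ((X s0 * c + Y s0 * s) * (X s0 * c + Y s0 * s)))
      = (X s0 * Y' - Y s0 * X') / ((X s0)^2 + (Y s0)^2)"
    unfolding R0 using R by (simp add: field_simps power2_eq_square)
  finally show ?thesis
    by (rule has_field_derivative_transform_within_open[OF _ V]) (simp add: h_eq c_def s_def)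
qed

lemma polar_jacobian_identity:
  fixes X Y Xa Ya Xb Yb R :: real
  assumes "0 < R" "R^2 = X^2 + Y^2"
  shows "((X * Xa + Y * Ya) / R) * ((X * Yb - Y * Xb) / (X^2 + Y^2))
      - ((X * Xb + Y * Yb) / R) * ((X * Ya - Y * Xa) / (X^2 + Y^2)) = (Xa * Yb - Ya * Xb) / R"
proof -
  have nz: "X^2 + Y^2 \<noteq> 0"
    using assms by (metis less_irrefl zero_less_power2)
  have "((X * Xa + Y * Ya) / R) * ((X * Yb - Y * Xb) / (X^2 + Y^2))
      - ((X * Xb + Y * Yb) / R) * ((X * Ya - Y * Xa) / (X^2 + Y^2))
      = ((X * Xa + Y * Ya) * (X * Yb - Y * Xb) - (X * Xb + Y * Yb) * (X * Ya - Y * Xa)) / (R * (X^2 + Y^2))"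
    by (simp only: times_divide_times_eq) (simp only: diff_divide_distrib)
  also have "(X * Xa + Y * Ya) * (X * Yb - Y * Xb) - (X * Xb + Y * Yb) * (X * Ya - Y * Xa)
      = (X^2 + Y^2) * (Xa * Yb - Ya * Xb)"
    by algebra
  also have "(X^2 + Y^2) * (Xa * Yb - Ya * Xb) / (R * (X^2 + Y^2)) = (Xa * Yb - Ya * Xb) / R"
    using nz by simp
  finally show ?thesis .
qed

lemma det_affine_columns:
  fixes P Q S t wa wb ca cb ka kb :: real
  shows "(P * t * wa + ca * S) * (Q * t * wb + kb * S) - (Q * t * wa + ka * S) * (P * t * wb + cb * S)
    = t * S * (P * (wa * kb - wb * ka) + Q * (ca * wb - wa * cb)) + S^2 * (ca * kb - ka * cb)"
  by (simp add: algebra_simps power2_eq_square)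

lemma jacobian_numerator_identity:
  fixes a b p q S C r w t :: real
  assumes p: "0 < p" and q: "0 < q" and pq: "p^2 + q^2 = 1"
    and r: "r = a^2 + (b^2 - a^2) * p^2" and r_pos: "0 < r"
  shows "r * ((((b^2 - a^2) * p * q / r * C - S) * t * (- a * w^3) + - a * q / (r * p) * S)
        * (a * b / r * C * t * (- b * w^3) + a / r * S)
      - (a * b / r * C * t * (- a * w^3) + b / r * S)
        * (((b^2 - a^2) * p * q / r * C - S) * t * (- b * w^3) + b * p / (r * q) * S))
    = S * ((w * t) * w^2 * (C * (a^2 * p^2 + b^2 * q^2) - (b^2 - a^2) * p * q * S) - S) / (p * q)"
proof -
  have nz: "p \<noteq> 0" "q \<noteq> 0" "r \<noteq> 0"
    using p q r_pos by auto
  have r': "r = a^2 * q^2 + b^2 * p^2"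
    using pq r by algebra
  define P Q where "P = (b^2 - a^2) * p * q / r * C - S" and "Q = a * b / r * C"
  have c1: "(- a * w^3) * (a / r) - (- b * w^3) * (b / r) = w^3 * (b^2 - a^2) / r"
    using nz by (simp add: field_simps power2_eq_square)
  have "(- a * q / (r * p)) * (- b * w^3) - (- a * w^3) * (b * p / (r * q))
      = a * b * w^3 * (p^2 + q^2) / (r * p * q)"
    using nz by (simp add: field_simps power2_eq_square)
  then have c2: "(- a * q / (r * p)) * (- b * w^3) - (- a * w^3) * (b * p / (r * q)) = a * b * w^3 / (r * p * q)"
    using pq by simp
  have "(- a * q / (r * p)) * (a / r) - (b / r) * (b * p / (r * q)) = - (a^2 * q^2 + b^2 * p^2) / (r * r * p * q)"
    using nz by (simp add: field_simps power2_eq_square)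
  then have c3: "(- a * q / (r * p)) * (a / r) - (b / r) * (b * p / (r * q)) = - 1 / (r * p * q)"
    using nz by (simp add: r'[symmetric])
  have "(b^2 - a^2)^2 * p^2 * q^2 + a^2 * b^2 = (b^2 - a^2)^2 * p^2 * q^2 + a^2 * b^2 * (p^2 + q^2)^2"
    using pq by simp
  also have "\<dots> = r * (a^2 * p^2 + b^2 * q^2)"
    unfolding r' by algebra
  finally have c4: "(b^2 - a^2)^2 * p^2 * q^2 + a^2 * b^2 = r * (a^2 * p^2 + b^2 * q^2)" .
  have "(b^2 - a^2) * p * q * P + Q * a * b
      = (C * ((b^2 - a^2)^2 * p^2 * q^2 + a^2 * b^2) - (b^2 - a^2) * p * q * S * r) / r"
    unfolding P_def Q_def using nz by (simp add: field_simps power2_eq_square)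
  also have "\<dots> = C * (a^2 * p^2 + b^2 * q^2) - (b^2 - a^2) * p * q * S"
    unfolding c4 using nz by (simp add: field_simps)
  finally have sub: "(b^2 - a^2) * p * q * P + Q * a * b = C * (a^2 * p^2 + b^2 * q^2) - (b^2 - a^2) * p * q * S" .
  have "r * ((P * t * (- a * w^3) + - a * q / (r * p) * S) * (Q * t * (- b * w^3) + a / r * S)
      - (Q * t * (- a * w^3) + b / r * S) * (P * t * (- b * w^3) + b * p / (r * q) * S))
      = r * (t * S * (P * (w^3 * (b^2 - a^2) / r) + Q * (a * b * w^3 / (r * p * q))) + S^2 * (- 1 / (r * p * q)))"
    unfolding det_affine_columns c1 c2 c3 by simp
  also have "\<dots> = S * (t * w^3 * ((b^2 - a^2) * p * q * P + Q * a * b) - S) / (p * q)"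
    using nz by (simp add: field_simps power2_eq_square)
  also have "\<dots> = S * ((w * t) * w^2 * (C * (a^2 * p^2 + b^2 * q^2) - (b^2 - a^2) * p * q * S) - S) / (p * q)"
    unfolding sub by (simp add: power3_eq_cube power2_eq_square mult.commute mult.left_commute)
  finally show ?thesis
    unfolding P_def Q_def .
qed

lemma Dexpr_numerator_identity:
  fixes a b p q S C w t :: real
  assumes p: "0 < p" and q: "0 < q" and pq: "p^2 + q^2 = 1"
  shows "w^3 * t * ((q / p * b^2 - p / q * a^2) * (S * q + C * p) * (C * q - S * p)
        + a^2 * (S * q + C * p)^2 - b^2 * (C * q - S * p)^2)
      + 2 * (S * q + C * p) * (C * q - S * p) - p / q * (C * q - S * p)^2 - q / p * (S * q + C * p)^2
    = S * ((w * t) * w^2 * (C * (a^2 * p^2 + b^2 * q^2) - (b^2 - a^2) * p * q * S) - S) / (p * q)"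
proof -
  have nz: "p \<noteq> 0" "q \<noteq> 0"
    using p q by auto
  define s c where "s = S * q + C * p" and "c = C * q - S * p"
  have L: "(q^2 * b^2 - p^2 * a^2) * s * c + p * q * (a^2 * s^2 - b^2 * c^2)
      = S * (C * (a^2 * p^2 + b^2 * q^2) - (b^2 - a^2) * p * q * S) * (p^2 + q^2)"
    unfolding s_def c_def by algebra
  have N: "2 * p * q * s * c - p^2 * c^2 - q^2 * s^2 = - ((S * (p^2 + q^2))^2)"
    unfolding s_def c_def by algebra
  have "(p * q) * (w^3 * t * ((q / p * b^2 - p / q * a^2) * s * c + a^2 * s^2 - b^2 * c^2)
        + 2 * s * c - p / q * c^2 - q / p * s^2)
      = w^3 * t * ((q^2 * b^2 - p^2 * a^2) * s * c + p * q * (a^2 * s^2 - b^2 * c^2))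
        + (2 * p * q * s * c - p^2 * c^2 - q^2 * s^2)"
    using nz by (simp add: field_simps power2_eq_square)
  also have "\<dots> = S * ((w * t) * w^2 * (C * (a^2 * p^2 + b^2 * q^2) - (b^2 - a^2) * p * q * S) - S)"
    unfolding L N pq by algebra
  finally show ?thesis
    using nz unfolding s_def[symmetric] c_def[symmetric] by (simp add: field_simps)
qed

lemma x_cos_less_sin:
  fixes x :: real
  assumes "0 < x" "x \<le> pi"
  shows "x * cos x < sin x"
proof -
  define f where "f y = sin y - y * cos y" for y :: real
  have "\<And>y. 0 \<le> y \<Longrightarrow> y \<le> x \<Longrightarrow> DERIV f y :> y * sin y"
    unfolding f_def by (auto intro!: derivative_eq_intros)
  from MVT2[OF assms(1) this] obtain z where z: "0 < z" "z < x" "f x - f 0 = (x - 0) * (z * sin z)"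
    by blast
  have "0 < sin z"
    using z assms by (intro sin_gt_zero) auto
  with z assms have "0 < f x - f 0"
    by simp
  then show ?thesis
    by (simp add: f_def)
qed

lemma sin_bracket_neg:
  fixes x k B :: real
  assumes "0 < x" "x < pi" "0 \<le> k" "k < 1" "0 \<le> B"
  shows "x * (k * cos x - B * sin x) - sin x < 0"
proof -
  have S: "0 < sin x"
    using assms by (intro sin_gt_zero) auto
  have "x * (k * cos x) < sin x"
  proof (cases "cos x \<le> 0")
    case True
    then have "x * (k * cos x) \<le> 0"
      using assms by (simp add: mult_nonneg_nonpos)
    with S show ?thesis
      by linarith
  next
    case False
    then have "x * (k * cos x) \<le> x * cos x"
      using assms by (intro mult_left_mono) (auto simp: mult_le_cancel_right1)
    with x_cos_less_sin[of x] assms show ?thesis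
      by linarith
  qed
  moreover have "0 \<le> x * B * sin x"
    using assms S by simp
  ultimately show ?thesis
    by (simp add: algebra_simps)
qed

definition sinc :: "real \<Rightarrow> real" where
  "sinc w = sin w / w"

definition osc_dw :: "real \<Rightarrow> real \<Rightarrow> real \<Rightarrow> real" where
  "osc_dw p0 p w = - p0 * sin w + p * (w * cos w - sin w) / w^2"

definition osc_z_dp :: "real \<Rightarrow> real \<Rightarrow> real \<Rightarrow> real" where
  "osc_z_dp p0 p w = p * (w - sin w * cos w) / w^2 + p0 * (sin w)^2 / w"

lemma Exp_jacobian_identity:
  fixes x0 y0 u v w s c r :: real
  assumes "w \<noteq> 0" "s^2 + c^2 = 1" "r = x0^2 + y0^2"
  shows "(s / w) * (r * (1 + c^2 - s^2) / 2
      + (u^2 + v^2) * (w * (1 - c^2 + s^2) - 2 * (w - s * c)) / (2 * w^3)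
      + (x0 * u + y0 * v) * (2 * w * s * c - s^2) / w^2)
    - (- x0 * s + u * (w * c - s) / w^2) * (u * (w - s * c) / w^2 + x0 * s^2 / w)
    - (- y0 * s + v * (w * c - s) / w^2) * (v * (w - s * c) / w^2 + y0 * s^2 / w)
    = (r + x0 * u + y0 * v) * s / w + (u^2 + v^2) * (s - w * c) / w^3"
proof -
  have "1 + c^2 - s^2 = 2 - 2 * s^2" "1 - c^2 + s^2 = 2 * s^2"
    using assms(2) by simp_all
  then show ?thesis
    unfolding assms(3) using assms(1,2) by (simp add: field_simps) algebra
qed

section \<open>Normal trajectories from an off-axis point\<close>

locale off_axis_point =
  fixes x0 y0 z0 :: real
  assumes off_axis: "0 < x0^2 + y0^2"
begin

definition r0sq :: real where
  "r0sq = x0^2 + y0^2"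

lemma r0sq_pos: "0 < r0sq"
  using off_axis by (simp add: r0sq_def)

lemma r0sq_nonzero: "r0sq \<noteq> 0"
  using r0sq_pos by simp

definition osc_z :: "real \<Rightarrow> real \<Rightarrow> real \<Rightarrow> real \<Rightarrow> real" where
  "osc_z u v w t = z0 + r0sq * (w * t + sin (w * t) * cos (w * t)) / 2
     + (u^2 + v^2) * (w * t - sin (w * t) * cos (w * t)) / (2 * w^2)
     + (x0 * u + y0 * v) * (sin (w * t))^2 / w"

lemma osc_z_has_derivative:
  "(osc_z u v w has_real_derivative ((osc x0 u w t)^2 + (osc y0 v w t)^2) * w) (at t)"
  if "w \<noteq> 0"
  unfolding osc_z_def[abs_def] osc_def using that
  apply (auto intro!: derivative_eq_intros)
  apply (simp add: field_simps power2_eq_square r0sq_def)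
  using sin_cos_squared_add[of "t * w"] by algebra

definition osc_traj :: "real \<times> real \<times> real \<Rightarrow> real \<Rightarrow> real \<times> real \<times> real" where
  "osc_traj l t = (case l of (u, v, w) \<Rightarrow> (osc x0 u w t, osc y0 v w t, osc_z u v w t))"

definition osc_covec :: "real \<times> real \<times> real \<Rightarrow> real \<Rightarrow> real \<times> real \<times> real" where
  "osc_covec l t = (case l of (u, v, w) \<Rightarrow> (osc_vel x0 u w t, osc_vel y0 v w t, w))"

lemma normal_lift_osc:
  assumes "w \<noteq> 0"
  shows "normal_lift (x0, y0, z0) (u, v, w) (osc_traj (u, v, w)) (osc_covec (u, v, w))"
  unfolding normal_lift_def osc_traj_def osc_covec_def
  using assms
  by (auto intro!: has_vector_derivative_Pair has_real_derivative_iff_has_vector_derivative[THEN iffD1]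
        osc_has_derivative osc_vel_has_derivative osc_z_has_derivative)
    (simp_all add: osc_def osc_vel_def osc_z_def)

lemma normal_lift_unique:
  assumes w: "w \<noteq> 0" and lift: "normal_lift (x0, y0, z0) (u, v, w) q l"
  shows "q = osc_traj (u, v, w)"
proof -
  define qx qy qz where "qx t = fst (q t)" and "qy t = fst (snd (q t))" and "qz t = snd (snd (q t))"
    for t
  define lu lv lw where "lu t = fst (l t)" and "lv t = fst (snd (l t))" and "lw t = snd (snd (l t))"
    for t
  have q: "q t = (qx t, qy t, qz t)" and l: "l t = (lu t, lv t, lw t)" for t
    by (simp_all add: qx_def qy_def qz_def lu_def lv_def lw_def)
  have init: "qx 0 = x0" "qy 0 = y0" "qz 0 = z0" "lu 0 = u" "lv 0 = v" "lw 0 = w"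
    using lift by (simp_all add: normal_lift_def qx_def qy_def qz_def lu_def lv_def lw_def)
  have "(q has_vector_derivative (lu t, lv t, (qx t ^2 + qy t ^2) * lw t)) (at t)"
    and "(l has_vector_derivative (- (lw t ^2) * qx t, - (lw t ^2) * qy t, 0)) (at t)" for t
    using lift unfolding normal_lift_def by (metis (no_types, lifting) case_prod_conv q l)+
  note dq = has_vector_derivative_componentsD[OF this(1), folded qx_def qy_def qz_def]
   and dl = has_vector_derivative_componentsD[OF this(2), folded lu_def lv_def lw_def]
  have lw: "lw t = w" for t
    using DERIV_isconst_all[of lw t 0] dl(3) init by auto
  have dlu: "(lu has_real_derivative - (w^2 * qx t)) (at t)"
    and dlv: "(lv has_real_derivative - (w^2 * qy t)) (at t)" for t
    using dl(1,2)[of t] by (simp_all add: lw)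
  have qx: "qx t = osc x0 u w t" for t
    by (rule harmonic_oscillator_unique[OF w dq(1) dlu osc_has_derivative[OF w] osc_vel_has_derivative[OF w]])
      (simp_all add: init osc_def osc_vel_def)
  have qy: "qy t = osc y0 v w t" for t
    by (rule harmonic_oscillator_unique[OF w dq(2) dlv osc_has_derivative[OF w] osc_vel_has_derivative[OF w]])
      (simp_all add: init osc_def osc_vel_def)
  have "((\<lambda>t. qz t - osc_z u v w t) has_real_derivative 0) (at t)" for t
    using DERIV_diff[OF dq(3) osc_z_has_derivative[where u = u and v = v, OF w]] by (simp add: qx qy lw)
  then have qz: "qz t = osc_z u v w t" for t
    using DERIV_isconst_all[of "\<lambda>t. qz t - osc_z u v w t" t 0] init by (simp add: osc_z_def)
  show ?thesis
    by (auto simp: q qx qy qz osc_traj_def)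
qed

lemma normal_traj_eq_osc_traj:
  assumes "snd (snd l) \<noteq> 0"
  shows "normal_traj (x0, y0, z0) l = osc_traj l"
proof -
  obtain u v w where l: "l = (u, v, w)" and w: "w \<noteq> 0"
    using assms by (cases l) auto
  show ?thesis
    unfolding normal_traj_def l
    by (rule the_equality) (use normal_lift_osc[OF w] normal_lift_unique[OF w] in blast)+
qed

subsection \<open>The extreme radii as coordinates\<close>

definition chart_dom :: "(real \<times> real) set" where
  "chart_dom = {0<..<sqrt r0sq} \<times> {sqrt r0sq<..}"

definition covec_dom :: "(real \<times> real \<times> real) set" where
  "covec_dom = {l \<in> E1 (x0, y0, z0). Kof (x0, y0, z0) l > 0 \<and> Lof (x0, y0, z0) l > 0 \<and> wof l > 0}"

definition chart_w :: "real \<Rightarrow> real \<Rightarrow> real" where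
  "chart_w a b = 1 / sqrt (a^2 + b^2)"

definition chart_M :: "real \<Rightarrow> real \<Rightarrow> real" where
  "chart_M a b = (r0sq - a^2) * (b^2 - r0sq)"

definition chart_K :: "real \<Rightarrow> real \<Rightarrow> real" where
  "chart_K a b = a * b * chart_w a b"

definition chart_L :: "real \<Rightarrow> real \<Rightarrow> real" where
  "chart_L a b = chart_w a b * sqrt (chart_M a b)"

text \<open>\<open>(u, v)\<close> is recovered from \<open>K = x0 v - y0 u\<close> and \<open>L = x0 u + y0 v\<close>.\<close>
definition chart_inv :: "real \<times> real \<Rightarrow> real \<times> real \<times> real" where
  "chart_inv p = (case p of (a, b) \<Rightarrow>
     ((x0 * chart_L a b - y0 * chart_K a b) / r0sq, (y0 * chart_L a b + x0 * chart_K a b) / r0sq,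
      chart_w a b))"

lemma chart_domD:
  assumes "(a, b) \<in> chart_dom"
  shows "0 < a" "a^2 < r0sq" "r0sq < b^2" "a < b" "a^2 < b^2" "0 < chart_M a b" "0 < chart_w a b"
    "chart_w a b ^ 2 * (a^2 + b^2) = 1"
proof -
  have a: "0 < a" "a < sqrt r0sq" and b: "sqrt r0sq < b"
    using assms by (auto simp: chart_dom_def)
  show "0 < a" "a < b"
    using a b by linarith+
  show "a^2 < r0sq"
    using a r0sq_pos by (metis less_eq_real_def power_strict_mono real_sqrt_pow2 zero_less_numeral)
  moreover show "r0sq < b^2"
    using b r0sq_pos
    by (metis less_le_trans power_strict_mono real_sqrt_ge_zero real_sqrt_pow2 zero_less_numeral less_imp_le)
  ultimately show "a^2 < b^2" "0 < chart_M a b"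
    by (simp_all add: chart_M_def)
  have "0 < a^2 + b^2"
    using a by (simp add: add_pos_nonneg)
  then show "0 < chart_w a b" "chart_w a b ^ 2 * (a^2 + b^2) = 1"
    using a by (simp_all add: chart_w_def power_divide)
qed

lemma chart_dom_nonzero:
  "p \<in> chart_dom \<Longrightarrow> fst p \<noteq> 0 \<and> r0sq \<noteq> (fst p)^2 \<and> (snd p)^2 \<noteq> r0sq \<and> r0sq \<noteq> 0"
  using chart_domD[of "fst p" "snd p"] r0sq_pos by force

definition phase_angle :: "real \<Rightarrow> real \<Rightarrow> real" where
  "phase_angle a b = arcsin (sqrt ((r0sq - a^2) / (b^2 - a^2)))"

lemma phase_angle_props:
  assumes "(a, b) \<in> chart_dom"
  shows "0 < phase_angle a b" "phase_angle a b < pi / 2"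
    and "0 < sin (phase_angle a b)" "0 < cos (phase_angle a b)"
    and "r0sq - a^2 = (b^2 - a^2) * (sin (phase_angle a b))^2"
    and "b^2 - r0sq = (b^2 - a^2) * (cos (phase_angle a b))^2"
    and "sqrt (chart_M a b) = (b^2 - a^2) * sin (phase_angle a b) * cos (phase_angle a b)"
proof -
  note ab = chart_domD[OF assms]
  define x where "x = (r0sq - a^2) / (b^2 - a^2)"
  have x: "0 < x" "x < 1"
    using ab by (auto simp: x_def field_simps)
  then have sx: "0 < sqrt x" "sqrt x < 1"
    by auto
  have s: "sin (phase_angle a b) = sqrt x"
    unfolding phase_angle_def x_def[symmetric] using sx by (intro sin_arcsin) linarith+
  show "0 < phase_angle a b"
    unfolding phase_angle_def x_def[symmetric] using sx arcsin_less_arcsin[of 0 "sqrt x"] by simp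
  have "arcsin (sqrt x) < arcsin 1"
    by (intro arcsin_less_arcsin) (use sx in linarith)+
  then show "phase_angle a b < pi / 2"
    unfolding phase_angle_def x_def[symmetric] by simp
  with \<open>0 < phase_angle a b\<close> show "0 < cos (phase_angle a b)"
    by (simp add: cos_gt_zero)
  show "0 < sin (phase_angle a b)"
    using s sx by simp
  have s2: "(sin (phase_angle a b))^2 = x" and c2: "(cos (phase_angle a b))^2 = 1 - x"
    using s x by (simp_all add: cos_squared_eq)
  show sin2: "r0sq - a^2 = (b^2 - a^2) * (sin (phase_angle a b))^2"
    and cos2: "b^2 - r0sq = (b^2 - a^2) * (cos (phase_angle a b))^2"
    using ab unfolding s2 c2 by (simp_all add: x_def field_simps)
  have "chart_M a b = ((b^2 - a^2) * sin (phase_angle a b) * cos (phase_angle a b))^2"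
    unfolding chart_M_def sin2 cos2 by (simp add: power_mult_distrib power2_eq_square)
  moreover have "0 \<le> (b^2 - a^2) * sin (phase_angle a b) * cos (phase_angle a b)"
    using ab \<open>0 < sin (phase_angle a b)\<close> \<open>0 < cos (phase_angle a b)\<close> by simp
  ultimately show "sqrt (chart_M a b) = (b^2 - a^2) * sin (phase_angle a b) * cos (phase_angle a b)"
    by simp
qed

lemma phase_eq_phase_angle:
  assumes "(a, b) \<in> chart_dom"
  shows "phase (sqrt r0sq) a b = phase_angle a b"
  unfolding phase_def
proof (rule the_equality)
  note ph = phase_angle_props[OF assms]
  show "0 < phase_angle a b \<and> phase_angle a b < pi / 2
      \<and> (sqrt r0sq)^2 = a^2 + (b^2 - a^2) * (sin (phase_angle a b))^2"
    using ph(1,2,5) r0sq_pos by simp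
  fix \<phi>
  assume \<phi>: "0 < \<phi> \<and> \<phi> < pi / 2 \<and> (sqrt r0sq)^2 = a^2 + (b^2 - a^2) * (sin \<phi>)^2"
  have "(sin \<phi>)^2 = (sin (phase_angle a b))^2"
    using \<phi> ph(5) r0sq_pos chart_domD(5)[OF assms] by simp
  moreover have "0 < sin \<phi>"
    using \<phi> by (intro sin_gt_zero) auto
  ultimately have "sin \<phi> = sin (phase_angle a b)"
    using ph(3) by (metis less_eq_real_def power2_eq_imp_eq)
  then have "arcsin (sin \<phi>) = arcsin (sin (phase_angle a b))"
    by simp
  then show "\<phi> = phase_angle a b"
    using \<phi> ph(1,2) by (simp add: arcsin_sin)
qed

text \<open>In complex notation \<open>x + i y = (x0 + i y0) (mult_re + i mult_im)\<close> along \<open>chart_inv (a, b)\<close>.\<close>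
definition coef_L :: "real \<Rightarrow> real \<Rightarrow> real" where
  "coef_L a b = sqrt (chart_M a b) / r0sq"

definition coef_K :: "real \<Rightarrow> real \<Rightarrow> real" where
  "coef_K a b = a * b / r0sq"

definition mult_re :: "real \<Rightarrow> real \<Rightarrow> real \<Rightarrow> real" where
  "mult_re a b t = cos (chart_w a b * t) + coef_L a b * sin (chart_w a b * t)"

definition mult_im :: "real \<Rightarrow> real \<Rightarrow> real \<Rightarrow> real" where
  "mult_im a b t = coef_K a b * sin (chart_w a b * t)"

definition chart_x :: "real \<Rightarrow> real \<Rightarrow> real \<Rightarrow> real" where
  "chart_x a b t = x0 * mult_re a b t - y0 * mult_im a b t"

definition chart_y :: "real \<Rightarrow> real \<Rightarrow> real \<Rightarrow> real" where
  "chart_y a b t = y0 * mult_re a b t + x0 * mult_im a b t"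

lemma normal_traj_chart_inv:
  assumes "(a, b) \<in> chart_dom"
  shows "fst (normal_traj (x0, y0, z0) (chart_inv (a, b)) t) = chart_x a b t"
    and "fst (snd (normal_traj (x0, y0, z0) (chart_inv (a, b)) t)) = chart_y a b t"
proof -
  have w: "chart_w a b \<noteq> 0"
    using chart_domD[OF assms] by simp
  then have w': "snd (snd (chart_inv (a, b))) \<noteq> 0"
    by (simp add: chart_inv_def)
  show "fst (normal_traj (x0, y0, z0) (chart_inv (a, b)) t) = chart_x a b t"
    and "fst (snd (normal_traj (x0, y0, z0) (chart_inv (a, b)) t)) = chart_y a b t"
    unfolding normal_traj_eq_osc_traj[OF w']
    using w r0sq_pos
    by (simp_all add: osc_traj_def chart_inv_def osc_def chart_x_def chart_y_def mult_re_def
        mult_im_def coef_L_def coef_K_def chart_L_def chart_K_def field_simps)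
qed

lemma chart_radius_sq:
  assumes "(a, b) \<in> chart_dom"
  shows "(chart_x a b t)^2 + (chart_y a b t)^2
    = a^2 + (b^2 - a^2) * (sin (chart_w a b * t + phase_angle a b))^2"
proof -
  note ph = phase_angle_props[OF assms]
  define p q S C where "p = sin (phase_angle a b)" and "q = cos (phase_angle a b)"
    and "S = sin (chart_w a b * t)" and "C = cos (chart_w a b * t)"
  have pq: "p^2 + q^2 = 1" and SC: "S^2 + C^2 = 1"
    by (simp_all add: p_def q_def S_def C_def)
  have r: "r0sq = a^2 + (b^2 - a^2) * p^2"
    using ph(5) by (simp add: p_def)
  have "(chart_x a b t)^2 + (chart_y a b t)^2 = r0sq * ((mult_re a b t)^2 + (mult_im a b t)^2)"
    by (simp add: chart_x_def chart_y_def r0sq_def power2_eq_square algebra_simps)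
  also have "\<dots> = r0sq * ((C + (b^2 - a^2) * p * q / r0sq * S)^2 + (a * b / r0sq * S)^2)"
    by (simp add: mult_re_def mult_im_def coef_L_def coef_K_def ph(7) p_def q_def S_def C_def)
  also have "\<dots> = (r0sq^2 * C^2 + 2 * r0sq * (b^2 - a^2) * p * q * S * C
      + ((b^2 - a^2)^2 * p^2 * q^2 + a^2 * b^2) * S^2) / r0sq"
    using r0sq_pos by (simp add: field_simps power2_eq_square)
  also have "(b^2 - a^2)^2 * p^2 * q^2 + a^2 * b^2 = r0sq * (a^2 * p^2 + b^2 * q^2)"
    using pq r by algebra
  also have "(r0sq^2 * C^2 + 2 * r0sq * (b^2 - a^2) * p * q * S * C
      + r0sq * (a^2 * p^2 + b^2 * q^2) * S^2) / r0sq
      = r0sq * C^2 + 2 * (b^2 - a^2) * p * q * S * C + (a^2 * p^2 + b^2 * q^2) * S^2"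
    using r0sq_pos by (simp add: field_simps power2_eq_square)
  also have "\<dots> = a^2 + (b^2 - a^2) * (S * q + C * p)^2"
    using pq SC r by algebra
  also have "S * q + C * p = sin (chart_w a b * t + phase_angle a b)"
    by (simp add: sin_add S_def C_def p_def q_def)
  finally show ?thesis .
qed

lemma chart_radius_sq_pos:
  assumes "(a, b) \<in> chart_dom"
  shows "0 < (chart_x a b t)^2 + (chart_y a b t)^2"
proof -
  have "a^2 \<le> a^2 + (b^2 - a^2) * (sin (chart_w a b * t + phase_angle a b))^2"
    using chart_domD(5)[OF assms] by simp
  then show ?thesis
    unfolding chart_radius_sq[OF assms] using chart_domD(1)[OF assms]
    by (smt (verit) zero_less_power2)
qed

abbreviation radius :: "real \<times> real \<times> real \<Rightarrow> real \<Rightarrow> real" where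
  "radius l t \<equiv> cyl_r (normal_traj (x0, y0, z0) l t)"

lemma radius_chart_inv:
  assumes "(a, b) \<in> chart_dom"
  shows "radius (chart_inv (a, b)) t = sqrt ((chart_x a b t)^2 + (chart_y a b t)^2)"
  using normal_traj_chart_inv[OF assms, of t]
  by (simp add: cyl_r_def case_prod_beta)

lemma radius_chart_inv_sq:
  assumes "(a, b) \<in> chart_dom"
  shows "(radius (chart_inv (a, b)) t)^2
    = a^2 + (b^2 - a^2) * (sin (chart_w a b * t + phase_angle a b))^2"
proof -
  have "0 \<le> a^2 + (b^2 - a^2) * (sin (chart_w a b * t + phase_angle a b))^2"
    using chart_domD(5)[OF assms] by (intro add_nonneg_nonneg mult_nonneg_nonneg) simp_all
  then show ?thesis
    using radius_chart_inv[OF assms] chart_radius_sq[OF assms] by simp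
qed

lemma radius_chart_inv_bounds:
  assumes "(a, b) \<in> chart_dom"
  shows "a \<le> radius (chart_inv (a, b)) t" "radius (chart_inv (a, b)) t \<le> b"
proof -
  note ab = chart_domD[OF assms]
  define s where "s = (sin (chart_w a b * t + phase_angle a b))^2"
  have "0 \<le> s" "s \<le> 1"
    by (simp_all add: s_def abs_square_le_1)
  moreover have "0 \<le> b^2 - a^2"
    using ab(5) by simp
  ultimately have "a^2 \<le> a^2 + (b^2 - a^2) * s" "a^2 + (b^2 - a^2) * s \<le> b^2"
    using mult_left_le[of s "b^2 - a^2"] by simp_all
  then show "a \<le> radius (chart_inv (a, b)) t" "radius (chart_inv (a, b)) t \<le> b"
    unfolding radius_chart_inv[OF assms] chart_radius_sq[OF assms] s_def[symmetric]
    using ab(1,4) real_sqrt_le_mono[of "a^2"] real_sqrt_le_mono[of _ "b^2"] by auto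
qed

lemma radius_chart_inv_extremes:
  assumes "(a, b) \<in> chart_dom"
  shows "radius (chart_inv (a, b)) ((real n * pi - phase_angle a b) / chart_w a b) = a"
    and "radius (chart_inv (a, b)) ((real n * pi + pi / 2 - phase_angle a b) / chart_w a b) = b"
proof -
  note ab = chart_domD[OF assms]
  have "(sin (real n * pi + pi / 2))^2 = 1"
    by (cases "even n") (simp_all add: sin_add)
  then show "radius (chart_inv (a, b)) ((real n * pi - phase_angle a b) / chart_w a b) = a"
    and "radius (chart_inv (a, b)) ((real n * pi + pi / 2 - phase_angle a b) / chart_w a b) = b"
    unfolding radius_chart_inv[OF assms] chart_radius_sq[OF assms] using ab by simp_all
qed

lemma rmin_chart_inv: "(a, b) \<in> chart_dom \<Longrightarrow> rmin (x0, y0, z0) (chart_inv (a, b)) = a"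
  unfolding rmin_def
  by (rule cInf_eq_minimum) (auto simp: radius_chart_inv_bounds intro: range_eqI
      radius_chart_inv_extremes(1)[of a b 0, symmetric])

lemma rmax_chart_inv: "(a, b) \<in> chart_dom \<Longrightarrow> rmax (x0, y0, z0) (chart_inv (a, b)) = b"
  unfolding rmax_def
  by (rule cSup_eq_maximum) (auto simp: radius_chart_inv_bounds intro: range_eqI
      radius_chart_inv_extremes(2)[of a b 0, symmetric])

lemma rotation_inverse:
  "x0 * ((y0 * L + x0 * K) / r0sq) - y0 * ((x0 * L - y0 * K) / r0sq) = K"
  "x0 * ((x0 * L - y0 * K) / r0sq) + y0 * ((y0 * L + x0 * K) / r0sq) = L"
proof -
  have "x0 * (y0 * L + x0 * K) - y0 * (x0 * L - y0 * K) = r0sq * K"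
    "x0 * (x0 * L - y0 * K) + y0 * (y0 * L + x0 * K) = r0sq * L"
    by (simp_all add: r0sq_def algebra_simps power2_eq_square)
  moreover have "x0 * (A / r0sq) - y0 * (B / r0sq) = (x0 * A - y0 * B) / r0sq"
    "x0 * (A / r0sq) + y0 * (B / r0sq) = (x0 * A + y0 * B) / r0sq" for A B
    by (simp_all add: diff_divide_distrib add_divide_distrib)
  ultimately show "x0 * ((y0 * L + x0 * K) / r0sq) - y0 * ((x0 * L - y0 * K) / r0sq) = K"
    "x0 * ((x0 * L - y0 * K) / r0sq) + y0 * ((y0 * L + x0 * K) / r0sq) = L"
    using r0sq_pos by simp_all
qed

lemma rotation_norm: "(x0 * L - y0 * K)^2 + (y0 * L + x0 * K)^2 = r0sq * (L^2 + K^2)"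
  by (simp add: r0sq_def algebra_simps power2_eq_square)

lemma mem_covec_dom_iff:
  "(u, v, w) \<in> covec_dom \<longleftrightarrow>
     u^2 + v^2 + r0sq * w^2 = 1 \<and> 0 < x0 * v - y0 * u \<and> 0 < x0 * u + y0 * v \<and> 0 < w"
  by (auto simp: covec_dom_def E1_def Kof_def Lof_def wof_def cyl_r_def r0sq_def)

lemma Kof_chart_inv: "Kof (x0, y0, z0) (chart_inv (a, b)) = chart_K a b"
  and wof_chart_inv: "wof (chart_inv (a, b)) = chart_w a b"
  by (simp_all add: Kof_def wof_def chart_inv_def rotation_inverse del: times_divide_eq_right)

lemma chart_inv_in_covec_dom:
  assumes "(a, b) \<in> chart_dom"
  shows "chart_inv (a, b) \<in> covec_dom"
proof -
  note ab = chart_domD[OF assms]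
  define K L W where "K = chart_K a b" and "L = chart_L a b" and "W = chart_w a b"
  have "L^2 + K^2 = W^2 * (chart_M a b + a^2 * b^2)"
    using ab by (simp add: K_def L_def W_def chart_L_def chart_K_def power_mult_distrib algebra_simps)
  also have "chart_M a b + a^2 * b^2 = r0sq * (a^2 + b^2) - r0sq^2"
    by (simp add: chart_M_def algebra_simps power2_eq_square)
  finally have LK: "L^2 + K^2 = W^2 * (r0sq * (a^2 + b^2) - r0sq^2)" .
  have "((x0 * L - y0 * K) / r0sq)^2 + ((y0 * L + x0 * K) / r0sq)^2 = (L^2 + K^2) / r0sq"
    unfolding power_divide add_divide_distrib[symmetric] rotation_norm
    using r0sq_pos by (simp add: power2_eq_square)
  also have "\<dots> = W^2 * (a^2 + b^2) - r0sq * W^2"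
    unfolding LK using r0sq_pos by (simp add: field_simps power2_eq_square)
  also have "\<dots> = 1 - r0sq * W^2"
    using ab(8) by (simp add: W_def)
  finally have "((x0 * L - y0 * K) / r0sq)^2 + ((y0 * L + x0 * K) / r0sq)^2 + r0sq * W^2 = 1"
    by simp
  moreover have "0 < K" "0 < L"
    using ab by (simp_all add: K_def L_def chart_K_def chart_L_def)
  ultimately show ?thesis
    using ab by (simp add: chart_inv_def mem_covec_dom_iff rotation_inverse K_def L_def W_def
        del: times_divide_eq_right)
qed

text \<open>\<open>r_min\<^sup>2\<close> and \<open>r_max\<^sup>2\<close> are the roots of \<open>X\<^sup>2 - X / w\<^sup>2 + K\<^sup>2 / w\<^sup>2\<close>, since
  \<open>a\<^sup>2 + b\<^sup>2 = 1 / w\<^sup>2\<close> and \<open>a b = K / w\<close>.\<close>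
definition chart_explicit :: "real \<times> real \<times> real \<Rightarrow> real \<times> real" where
  "chart_explicit l =
     (root_lo (1 / (wof l)^2) ((Kof (x0, y0, z0) l / wof l)^2),
      root_hi (1 / (wof l)^2) ((Kof (x0, y0, z0) l / wof l)^2))"

lemma covec_dom_discriminant_pos:
  assumes "(u, v, w) \<in> covec_dom"
  shows "4 * (x0 * v - y0 * u)^2 * w^2 < 1"
proof -
  define K L where "K = x0 * v - y0 * u" and "L = x0 * u + y0 * v"
  have l: "0 < K" "0 < L" "0 < w" "u^2 + v^2 = 1 - r0sq * w^2"
    using assms by (auto simp: mem_covec_dom_iff K_def L_def)
  have "K^2 + L^2 = r0sq * (u^2 + v^2)"
    by (simp add: K_def L_def r0sq_def algebra_simps power2_eq_square)
  then have "K^2 < r0sq * (1 - r0sq * w^2)"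
    using l by (smt (verit) zero_less_power2)
  then have "K^2 * (4 * w^2) < r0sq * (1 - r0sq * w^2) * (4 * w^2)"
    using l(3) by (intro mult_strict_right_mono) auto
  then have "4 * K^2 * w^2 < 4 * (r0sq * w^2) * (1 - r0sq * w^2)"
    by (simp add: algebra_simps)
  also have "\<dots> \<le> 1"
    using zero_le_power2[of "2 * (r0sq * w^2) - 1"] by (simp add: algebra_simps power2_eq_square)
  finally show ?thesis
    by (simp add: K_def)
qed

lemma chart_explicit_inverse:
  assumes "l \<in> covec_dom"
  shows "chart_explicit l \<in> chart_dom" "chart_inv (chart_explicit l) = l"
proof -
  obtain u v w where l_eq: "l = (u, v, w)"
    by (cases l) auto
  define K L where "K = x0 * v - y0 * u" and "L = x0 * u + y0 * v"
  have l: "0 < K" "0 < L" "0 < w" "u^2 + v^2 = 1 - r0sq * w^2"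
    using assms by (auto simp: l_eq mem_covec_dom_iff K_def L_def)
  obtain a b where ab_eq: "chart_explicit l = (a, b)"
    by (cases "chart_explicit l") auto
  have "4 * (K / w)^2 = (4 * K^2 * w^2) / w^4" "(1 / w^2)^2 = 1 / w^4"
    using l(3) by (simp_all add: field_simps power2_eq_square power4_eq_xxxx)
  then have "4 * (K / w)^2 < (1 / w^2)^2"
    using covec_dom_discriminant_pos[OF assms[unfolded l_eq]] l(3)
    by (simp add: K_def divide_strict_right_mono)
  then have "0 < a" "a < b" "a^2 + b^2 = 1 / w^2" "a * b = K / w"
    using root_lo_hi[of "(K / w)^2" "1 / w^2"] l ab_eq
    by (simp_all add: chart_explicit_def l_eq Kof_def wof_def K_def)
  then have w: "chart_w a b = w" and K: "chart_K a b = K"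
    using l(3) by (simp_all add: chart_w_def chart_K_def real_sqrt_divide)
  have "chart_M a b = r0sq * (a^2 + b^2) - r0sq^2 - (a * b)^2"
    by (simp add: chart_M_def algebra_simps power2_eq_square)
  also have "\<dots> = (L / w)^2"
    using l \<open>a^2 + b^2 = 1 / w^2\<close> \<open>a * b = K / w\<close> rotation_norm[of u v]
    by (simp add: K_def L_def r0sq_def power_divide field_simps power2_eq_square) algebra
  finally have M: "chart_M a b = (L / w)^2" .
  then have L: "chart_L a b = L"
    using l by (simp add: chart_L_def w)
  have "x0 * L - y0 * K = r0sq * u" "y0 * L + x0 * K = r0sq * v"
    by (simp_all add: K_def L_def r0sq_def algebra_simps power2_eq_square)
  then show "chart_inv (chart_explicit l) = l"
    unfolding ab_eq using r0sq_pos by (simp add: l_eq chart_inv_def w K L)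
  have "a^2 < b^2" "0 < chart_M a b"
    using \<open>0 < a\<close> \<open>a < b\<close> M l by (simp_all add: power_strict_mono)
  then have "a^2 < r0sq" "r0sq < b^2"
    unfolding chart_M_def by (smt (verit) mult_nonneg_nonpos mult_nonpos_nonneg)+
  then have "a < sqrt r0sq" "sqrt r0sq < b"
    using real_sqrt_less_mono[of r0sq "b^2"] \<open>0 < a\<close> \<open>a < b\<close> by (simp_all add: real_less_rsqrt)
  with \<open>0 < a\<close> show "chart_explicit l \<in> chart_dom"
    unfolding ab_eq chart_dom_def by simp
qed

definition chart :: "real \<times> real \<times> real \<Rightarrow> real \<times> real" where
  "chart l = (rmin (x0, y0, z0) l, rmax (x0, y0, z0) l)"

lemma chart_chart_inv: "p \<in> chart_dom \<Longrightarrow> chart (chart_inv p) = p"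
  by (cases p) (simp add: chart_def rmin_chart_inv rmax_chart_inv)

lemma chart_eq_chart_explicit: "l \<in> covec_dom \<Longrightarrow> chart l = chart_explicit l"
  using chart_chart_inv chart_explicit_inverse by metis

lemma chart_inv_chart: "l \<in> covec_dom \<Longrightarrow> chart_inv (chart l) = l"
  using chart_eq_chart_explicit chart_explicit_inverse(2) by metis

lemma chart_in_chart_dom: "l \<in> covec_dom \<Longrightarrow> chart l \<in> chart_dom"
  using chart_eq_chart_explicit chart_explicit_inverse(1) by metis

lemma bij_betw_chart: "bij_betw chart covec_dom chart_dom"
  by (rule bij_betw_byWitness[where f' = chart_inv])
    (auto simp: chart_inv_chart chart_chart_inv chart_inv_in_covec_dom chart_in_chart_dom)

lemma inv_into_chart: "p \<in> chart_dom \<Longrightarrow> inv_into covec_dom chart p = chart_inv p"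
  by (metis bij_betw_chart bij_betw_inv_into_left chart_chart_inv chart_inv_in_covec_dom
      prod.collapse)

lemma continuous_on_chart: "continuous_on covec_dom chart"
proof -
  have "continuous_on covec_dom chart_explicit"
    unfolding chart_explicit_def root_lo_def root_hi_def Kof_def wof_def case_prod_beta
    by (intro continuous_intros) (auto simp: covec_dom_def wof_def)
  then show ?thesis
    by (rule continuous_on_cong[THEN iffD1, rotated 2]) (auto simp: chart_eq_chart_explicit)
qed

lemma radius_chart_inv_recurrent:
  assumes "(a, b) \<in> chart_dom"
  shows "\<exists>t>T. radius (chart_inv (a, b)) t = a" "\<exists>t>T. radius (chart_inv (a, b)) t = b"
proof -
  have w: "0 < chart_w a b"
    using chart_domD[OF assms] by simp
  obtain n m :: nat where "T < (real n * pi - phase_angle a b) / chart_w a b"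
    and "T < (real m * pi + (pi / 2 - phase_angle a b)) / chart_w a b"
    using exists_nat_beyond[OF w] by (metis diff_conv_add_uminus)
  then show "\<exists>t>T. radius (chart_inv (a, b)) t = a" "\<exists>t>T. radius (chart_inv (a, b)) t = b"
    using radius_chart_inv_extremes[OF assms] by (metis add_diff_eq)+
qed

subsection \<open>Differentiability of the inverse chart\<close>

definition chart_w' :: "real \<Rightarrow> real \<Rightarrow> real \<times> real \<Rightarrow> real" where
  "chart_w' a b h = - (chart_w a b ^ 3) * (a * fst h + b * snd h)"

definition chart_sqrtM' :: "real \<Rightarrow> real \<Rightarrow> real \<times> real \<Rightarrow> real" where
  "chart_sqrtM' a b h =
     (- a * (b^2 - r0sq) * fst h + b * (r0sq - a^2) * snd h) / sqrt (chart_M a b)"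

definition chart_K' :: "real \<Rightarrow> real \<Rightarrow> real \<times> real \<Rightarrow> real" where
  "chart_K' a b h = chart_w a b * (b * fst h + a * snd h) + a * b * chart_w' a b h"

definition chart_L' :: "real \<Rightarrow> real \<Rightarrow> real \<times> real \<Rightarrow> real" where
  "chart_L' a b h = chart_w' a b h * sqrt (chart_M a b) + chart_w a b * chart_sqrtM' a b h"

definition chart_inv' :: "real \<times> real \<Rightarrow> real \<times> real \<Rightarrow> real \<times> real \<times> real" where
  "chart_inv' p h = (case p of (a, b) \<Rightarrow>
     ((x0 * chart_L' a b h - y0 * chart_K' a b h) / r0sq,
      (y0 * chart_L' a b h + x0 * chart_K' a b h) / r0sq, chart_w' a b h))"

lemma chart_w_has_derivative:
  assumes "(a, b) \<in> chart_dom"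
  shows "((\<lambda>p. chart_w (fst p) (snd p)) has_derivative chart_w' a b) (at (a, b))"
proof -
  have pos: "0 < a^2 + b^2"
    using chart_domD(1)[OF assms] by (simp add: add_pos_nonneg)
  have "((\<lambda>p. 1 / sqrt ((fst p)^2 + (snd p)^2)) has_derivative
      (\<lambda>h. 2 * (a * fst h + b * snd h) * (- (chart_w a b ^ 3 / 2)))) (at (a, b))"
  proof (rule DERIV_compose_FDERIV[where f = "\<lambda>s. 1 / sqrt s" and g = "\<lambda>p. (fst p)^2 + (snd p)^2"
        and x = "(a, b)"])
    show "((\<lambda>s. 1 / sqrt s) has_real_derivative - (chart_w a b ^ 3 / 2))
        (at ((fst (a, b))^2 + (snd (a, b))^2))"
      using pos by (auto intro!: derivative_eq_intros simp: chart_w_def power3_eq_cube divide_simps)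
    show "((\<lambda>p. (fst p)^2 + (snd p)^2) has_derivative (\<lambda>h. 2 * (a * fst h + b * snd h))) (at (a, b))"
      by (rule has_derivative_eq_rhs, (rule derivative_eq_intros refl)+) (simp add: fun_eq_iff algebra_simps)
  qed
  then show ?thesis
    unfolding chart_w_def[symmetric]
    by (rule has_derivative_eq_rhs) (simp add: chart_w'_def[abs_def] algebra_simps)
qed

lemma chart_M_has_derivative:
  "((\<lambda>p. chart_M (fst p) (snd p)) has_derivative
     (\<lambda>h. 2 * (- a * (b^2 - r0sq) * fst h + b * (r0sq - a^2) * snd h))) (at (a, b))"
  unfolding chart_M_def
  by (rule has_derivative_eq_rhs, (rule derivative_eq_intros refl)+) (simp add: fun_eq_iff algebra_simps)

lemma chart_sqrtM_has_derivative:
  assumes "(a, b) \<in> chart_dom"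
  shows "((\<lambda>p. sqrt (chart_M (fst p) (snd p))) has_derivative chart_sqrtM' a b) (at (a, b))"
proof -
  have M: "0 < chart_M a b"
    using chart_domD(6)[OF assms] .
  have "((\<lambda>p. sqrt (chart_M (fst p) (snd p))) has_derivative
      (\<lambda>h. 2 * (- a * (b^2 - r0sq) * fst h + b * (r0sq - a^2) * snd h) * (inverse (sqrt (chart_M a b)) / 2)))
      (at (a, b))"
  proof (rule DERIV_compose_FDERIV[where f = sqrt and g = "\<lambda>p. chart_M (fst p) (snd p)" and x = "(a, b)"])
    show "(sqrt has_real_derivative inverse (sqrt (chart_M a b)) / 2)
        (at (chart_M (fst (a, b)) (snd (a, b))))"
      using DERIV_real_sqrt[OF M] by simp
  qed (rule chart_M_has_derivative)
  then show ?thesis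
    by (rule has_derivative_eq_rhs[OF _ ext]) (use M in \<open>simp add: chart_sqrtM'_def field_simps\<close>)
qed

lemma chart_K_has_derivative:
  assumes "(a, b) \<in> chart_dom"
  shows "((\<lambda>p. chart_K (fst p) (snd p)) has_derivative chart_K' a b) (at (a, b))"
  unfolding chart_K_def
  by (rule has_derivative_eq_rhs, (rule chart_w_has_derivative[OF assms] derivative_eq_intros refl)+)
    (simp add: chart_K'_def fun_eq_iff algebra_simps)

lemma chart_L_has_derivative:
  assumes "(a, b) \<in> chart_dom"
  shows "((\<lambda>p. chart_L (fst p) (snd p)) has_derivative chart_L' a b) (at (a, b))"
  unfolding chart_L_def
  by (rule has_derivative_eq_rhs[OF has_derivative_mult[OF chart_w_has_derivative[OF assms]
        chart_sqrtM_has_derivative[OF assms]]]) (simp add: chart_L'_def fun_eq_iff algebra_simps)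

lemma chart_inv_has_derivative:
  assumes "p \<in> chart_dom"
  shows "(chart_inv has_derivative chart_inv' p) (at p)"
proof -
  obtain a b where p: "p = (a, b)" and ab: "(a, b) \<in> chart_dom"
    using assms by (cases p) auto
  have chart_inv_eq: "chart_inv = (\<lambda>p. ((x0 * chart_L (fst p) (snd p) - y0 * chart_K (fst p) (snd p)) / r0sq,
      (y0 * chart_L (fst p) (snd p) + x0 * chart_K (fst p) (snd p)) / r0sq, chart_w (fst p) (snd p)))"
    by (auto simp: chart_inv_def)
  show ?thesis
    unfolding chart_inv_eq p
    by (rule has_derivative_eq_rhs, (rule chart_w_has_derivative[OF ab] chart_K_has_derivative[OF ab]
          chart_L_has_derivative[OF ab] derivative_eq_intros refl r0sq_nonzero)+)
      (simp add: chart_inv'_def fun_eq_iff)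
qed

lemma inj_chart_inv':
  assumes "p \<in> chart_dom"
  shows "inj (chart_inv' p)"
proof -
  obtain a b where p: "p = (a, b)"
    by (cases p) auto
  note ab = chart_domD[OF assms[unfolded p]]
  have "h = 0" if h: "chart_inv' p h = 0" for h
  proof -
    have rot: "(x0 * chart_L' a b h - y0 * chart_K' a b h) / r0sq = 0"
      "(y0 * chart_L' a b h + x0 * chart_K' a b h) / r0sq = 0" and "chart_w' a b h = 0"
      using h by (simp_all add: chart_inv'_def p zero_prod_def del: divide_eq_0_iff)
    then have ah: "a * fst h + b * snd h = 0"
      using ab by (simp add: chart_w'_def)
    have "chart_K' a b h = 0"
      using rotation_inverse(1)[of "chart_L' a b h" "chart_K' a b h"] unfolding rot by simp
    then have bh: "b * fst h + a * snd h = 0"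
      using ab \<open>chart_w' a b h = 0\<close> by (simp add: chart_K'_def)
    have "(b^2 - a^2) * fst h = b * (b * fst h + a * snd h) - a * (a * fst h + b * snd h)"
      "(b^2 - a^2) * snd h = b * (a * fst h + b * snd h) - a * (b * fst h + a * snd h)"
      by (simp_all add: power2_eq_square algebra_simps)
    then have "(b^2 - a^2) * fst h = 0" "(b^2 - a^2) * snd h = 0"
      using ah bh by simp_all
    moreover have "b^2 - a^2 \<noteq> 0"
      using ab(5) by simp
    ultimately show "h = 0"
      by (simp add: prod_eq_iff)
  qed
  then show ?thesis
    using linear_inj_iff_eq_0[OF has_derivative_linear[OF chart_inv_has_derivative[OF assms]]]
    by blast
qed

lemma continuous_on_chart_inv':
  "continuous_on chart_dom (\<lambda>p. chart_inv' p (1, 0))"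
  "continuous_on chart_dom (\<lambda>p. chart_inv' p (0, 1))"
  unfolding chart_inv'_def chart_L'_def chart_K'_def chart_w'_def chart_sqrtM'_def chart_w_def
    chart_M_def case_prod_beta
  by (auto intro!: continuous_intros dest: chart_dom_nonzero)

lemma chart_inv_differentiable:
  "\<exists>\<Psi>'. (\<forall>p\<in>chart_dom. (inv_into covec_dom chart has_derivative \<Psi>' p) (at p) \<and> inj (\<Psi>' p))
     \<and> continuous_on chart_dom (\<lambda>p. \<Psi>' p (1, 0)) \<and> continuous_on chart_dom (\<lambda>p. \<Psi>' p (0, 1))"
proof (intro exI[of _ chart_inv'] conjI ballI continuous_on_chart_inv')
  fix p
  assume p: "p \<in> chart_dom"
  have "open chart_dom"
    unfolding chart_dom_def by (intro open_Times) auto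
  then show "(inv_into covec_dom chart has_derivative chart_inv' p) (at p)"
    by (rule has_derivative_transform_within_open[OF chart_inv_has_derivative[OF p] _ p])
      (simp add: inv_into_chart)
  show "inj (chart_inv' p)"
    using inj_chart_inv'[OF p] .
qed

subsection \<open>The Jacobian \<open>D\<close>\<close>

definition coef_L' :: "real \<Rightarrow> real \<Rightarrow> real \<times> real \<Rightarrow> real" where
  "coef_L' a b h = chart_sqrtM' a b h / r0sq"

definition coef_K' :: "real \<Rightarrow> real \<Rightarrow> real \<times> real \<Rightarrow> real" where
  "coef_K' a b h = (b * fst h + a * snd h) / r0sq"

definition mult_re' :: "real \<Rightarrow> real \<Rightarrow> real \<Rightarrow> real \<times> real \<Rightarrow> real" where
  "mult_re' a b t h = (coef_L a b * cos (chart_w a b * t) - sin (chart_w a b * t)) * t * chart_w' a b h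
     + coef_L' a b h * sin (chart_w a b * t)"

definition mult_im' :: "real \<Rightarrow> real \<Rightarrow> real \<Rightarrow> real \<times> real \<Rightarrow> real" where
  "mult_im' a b t h = coef_K a b * cos (chart_w a b * t) * t * chart_w' a b h
     + coef_K' a b h * sin (chart_w a b * t)"

definition chart_x' :: "real \<Rightarrow> real \<Rightarrow> real \<Rightarrow> real \<times> real \<Rightarrow> real" where
  "chart_x' a b t h = x0 * mult_re' a b t h - y0 * mult_im' a b t h"

definition chart_y' :: "real \<Rightarrow> real \<Rightarrow> real \<Rightarrow> real \<times> real \<Rightarrow> real" where
  "chart_y' a b t h = y0 * mult_re' a b t h + x0 * mult_im' a b t h"

lemma mult_re_has_derivative:
  assumes "(a, b) \<in> chart_dom"
  shows "((\<lambda>p. mult_re (fst p) (snd p) t) has_derivative mult_re' a b t) (at (a, b))"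
  unfolding mult_re_def coef_L_def
  by (rule has_derivative_eq_rhs, (rule chart_w_has_derivative[OF assms] chart_sqrtM_has_derivative[OF assms]
        derivative_eq_intros refl r0sq_nonzero)+)
    (simp add: mult_re'_def coef_L'_def coef_L_def fun_eq_iff algebra_simps)

lemma mult_im_has_derivative:
  assumes "(a, b) \<in> chart_dom"
  shows "((\<lambda>p. mult_im (fst p) (snd p) t) has_derivative mult_im' a b t) (at (a, b))"
  unfolding mult_im_def coef_K_def
  by (rule has_derivative_eq_rhs, (rule chart_w_has_derivative[OF assms]
        derivative_eq_intros refl r0sq_nonzero)+)
    (simp add: mult_im'_def coef_K'_def coef_K_def fun_eq_iff field_simps)

lemma chart_xy_partial_derivatives:
  assumes "(a, b) \<in> chart_dom"
  shows "((\<lambda>a'. chart_x a' b t) has_real_derivative chart_x' a b t (1, 0)) (at a)"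
    and "((\<lambda>b'. chart_x a b' t) has_real_derivative chart_x' a b t (0, 1)) (at b)"
    and "((\<lambda>a'. chart_y a' b t) has_real_derivative chart_y' a b t (1, 0)) (at a)"
    and "((\<lambda>b'. chart_y a b' t) has_real_derivative chart_y' a b t (0, 1)) (at b)"
proof -
  have "((\<lambda>p. chart_x (fst p) (snd p) t) has_derivative chart_x' a b t) (at (a, b))"
    and "((\<lambda>p. chart_y (fst p) (snd p) t) has_derivative chart_y' a b t) (at (a, b))"
    unfolding chart_x_def chart_y_def
    by (rule has_derivative_eq_rhs, (rule mult_re_has_derivative[OF assms] mult_im_has_derivative[OF assms]
          derivative_eq_intros refl)+, simp add: chart_x'_def chart_y'_def fun_eq_iff)+
  from this[THEN has_derivative_partial_fst] this[THEN has_derivative_partial_snd]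
  show "((\<lambda>a'. chart_x a' b t) has_real_derivative chart_x' a b t (1, 0)) (at a)"
    and "((\<lambda>b'. chart_x a b' t) has_real_derivative chart_x' a b t (0, 1)) (at b)"
    and "((\<lambda>a'. chart_y a' b t) has_real_derivative chart_y' a b t (1, 0)) (at a)"
    and "((\<lambda>b'. chart_y a b' t) has_real_derivative chart_y' a b t (0, 1)) (at b)"
    by simp_all
qed

text \<open>\<open>r D\<close>, in the form of the paper's bracket multiplied by \<open>sin \<phi> cos \<phi>\<close>.\<close>
definition jac_num :: "real \<Rightarrow> real \<Rightarrow> real \<Rightarrow> real" where
  "jac_num a b t =
     (let w = chart_w a b; p = sin (phase_angle a b); q = cos (phase_angle a b);
          S = sin (w * t); C = cos (w * t)
      in S * ((w * t) * w^2 * (C * (a^2 * p^2 + b^2 * q^2) - (b^2 - a^2) * p * q * S) - S) / (p * q))"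

lemma chart_jacobian_eq_jac_num:
  assumes "(a, b) \<in> chart_dom"
  shows "chart_x' a b t (1, 0) * chart_y' a b t (0, 1) - chart_y' a b t (1, 0) * chart_x' a b t (0, 1)
    = jac_num a b t"
proof -
  note ab = chart_domD[OF assms] and ph = phase_angle_props[OF assms]
  define p q where "p = sin (phase_angle a b)" and "q = cos (phase_angle a b)"
  have pq: "0 < p" "0 < q" "p^2 + q^2 = 1"
    using ph by (simp_all add: p_def q_def)
  have sqrtM: "sqrt (chart_M a b) = (b^2 - a^2) * p * q"
    using ph(7) by (simp add: p_def q_def)
  have nz: "b^2 - a^2 \<noteq> 0" "p \<noteq> 0" "q \<noteq> 0"
    using ab(5) pq by simp_all
  have pq_sq: "b^2 - r0sq = (b^2 - a^2) * q^2" "r0sq - a^2 = (b^2 - a^2) * p^2"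
    using ph(5,6) by (simp_all add: p_def q_def)
  have "- a * (b^2 - r0sq) / sqrt (chart_M a b) = - a * q / p"
    and "b * (r0sq - a^2) / sqrt (chart_M a b) = b * p / q"
    unfolding pq_sq sqrtM using nz by (simp_all add: field_simps power2_eq_square)
  then have "chart_sqrtM' a b (1, 0) = - a * q / p" "chart_sqrtM' a b (0, 1) = b * p / q"
    by (simp_all add: chart_sqrtM'_def)
  then have partials: "chart_w' a b (1, 0) = - a * chart_w a b ^ 3" "chart_w' a b (0, 1) = - b * chart_w a b ^ 3"
    "coef_K' a b (1, 0) = b / r0sq" "coef_K' a b (0, 1) = a / r0sq"
    "coef_L' a b (1, 0) = - a * q / (r0sq * p)" "coef_L' a b (0, 1) = b * p / (r0sq * q)"
    "coef_L a b = (b^2 - a^2) * p * q / r0sq" "coef_K a b = a * b / r0sq"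
    by (simp_all add: chart_w'_def coef_K'_def coef_L'_def coef_L_def coef_K_def sqrtM)
  have "chart_x' a b t (1, 0) * chart_y' a b t (0, 1) - chart_y' a b t (1, 0) * chart_x' a b t (0, 1)
      = r0sq * (mult_re' a b t (1, 0) * mult_im' a b t (0, 1) - mult_im' a b t (1, 0) * mult_re' a b t (0, 1))"
    by (simp add: chart_x'_def chart_y'_def r0sq_def algebra_simps power2_eq_square)
  also have "\<dots> = jac_num a b t"
    unfolding mult_re'_def mult_im'_def partials jac_num_def Let_def p_def[symmetric] q_def[symmetric]
    by (rule jacobian_numerator_identity[OF pq]) (use ph(5) r0sq_pos in \<open>simp_all add: p_def\<close>)
  finally show ?thesis .
qed

lemma Dexpr_eq_jac_num:
  assumes "(a, b) \<in> chart_dom"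
  shows "Dexpr (sqrt r0sq) a b t r = jac_num a b t / r"
proof -
  note ph = phase_angle_props[OF assms]
  define p q where "p = sin (phase_angle a b)" and "q = cos (phase_angle a b)"
  have pq: "0 < p" "0 < q" "p^2 + q^2 = 1"
    using ph by (simp_all add: p_def q_def)
  have "sin (chart_w a b * t + phase_angle a b) = sin (chart_w a b * t) * q + cos (chart_w a b * t) * p"
    "cos (chart_w a b * t + phase_angle a b) = cos (chart_w a b * t) * q - sin (chart_w a b * t) * p"
    "tan (phase_angle a b) = p / q" "cot (phase_angle a b) = q / p"
    by (simp_all add: sin_add cos_add tan_def cot_def p_def q_def)
  then show ?thesis
    unfolding Dexpr_def Let_def phase_eq_phase_angle[OF assms] chart_w_def[symmetric] jac_num_def
      p_def[symmetric] q_def[symmetric] Dexpr_numerator_identity[OF pq, symmetric]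
    by (simp add: mult.assoc)
qed

lemma jac_num_at_half_period: "(a, b) \<in> chart_dom \<Longrightarrow> jac_num a b (pi / chart_w a b) = 0"
  using chart_domD(7)[of a b] by (simp add: jac_num_def Let_def)

lemma jac_num_neg:
  assumes "(a, b) \<in> chart_dom" "0 < t" "t < pi / chart_w a b"
  shows "jac_num a b t < 0"
proof -
  note ab = chart_domD[OF assms(1)] and ph = phase_angle_props[OF assms(1)]
  define p q w where "p = sin (phase_angle a b)" and "q = cos (phase_angle a b)" and "w = chart_w a b"
  have pq: "0 < p" "0 < q" "p^2 + q^2 = 1"
    using ph by (simp_all add: p_def q_def)
  define x k B where "x = w * t" and "k = w^2 * (a^2 * p^2 + b^2 * q^2)"
    and "B = w^2 * ((b^2 - a^2) * p * q)"
  have x: "0 < x" "x < pi"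
    using assms ab(7) by (simp_all add: x_def w_def field_simps)
  have "p^2 < 1" "q^2 < 1"
    using pq by (smt (verit) zero_less_power2)+
  then have "a^2 * p^2 < a^2 * 1" "b^2 * q^2 < b^2 * 1"
    using ab(1,4) by (intro mult_strict_left_mono; simp)+
  then have "w^2 * (a^2 * p^2 + b^2 * q^2) < w^2 * (a^2 + b^2)"
    using ab(7) by (intro mult_strict_left_mono) (simp_all add: w_def)
  then have "k < 1"
    using ab(8) by (simp add: k_def w_def)
  moreover have "0 \<le> k" "0 \<le> B"
    using ab(5) pq by (simp_all add: k_def B_def)
  ultimately have "x * (k * cos x - B * sin x) - sin x < 0"
    by (intro sin_bracket_neg x)
  moreover have "0 < sin x"
    using x by (intro sin_gt_zero) auto
  moreover have "jac_num a b t = sin x * (x * (k * cos x - B * sin x) - sin x) / (p * q)"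
    unfolding jac_num_def Let_def w_def[symmetric] p_def[symmetric] q_def[symmetric] x_def[symmetric] k_def B_def
    by (simp add: algebra_simps)
  ultimately show ?thesis
    using pq by (simp add: mult_pos_neg divide_neg_pos)
qed

lemma Dexpr_first_zero:
  assumes ab: "(a, b) \<in> chart_dom"
  shows "let w0 = 1 / sqrt (a^2 + b^2);
      D = (\<lambda>t. Dexpr (sqrt r0sq) a b t (cyl_r (normal_traj (x0, y0, z0) (inv_into covec_dom chart (a, b)) t)))
    in D (pi / w0) = 0 \<and> (\<forall>t. 0 < t \<and> t < pi / w0 \<longrightarrow> D t \<noteq> 0)"
proof -
  have "0 < radius (inv_into covec_dom chart (a, b)) t" for t
    using chart_radius_sq_pos[OF ab] by (simp add: inv_into_chart[OF ab] radius_chart_inv[OF ab])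
  then have "radius (inv_into covec_dom chart (a, b)) t \<noteq> 0" for t
    by (metis less_irrefl)
  then show ?thesis
    unfolding Let_def Dexpr_eq_jac_num[OF ab] chart_w_def[symmetric]
    using jac_num_at_half_period[OF ab] jac_num_neg[OF ab] by (auto simp: less_imp_neq)
qed

lemma angle_lift_exists: "\<exists>\<Theta>. angle_lift (x0, y0, z0) (inv_into covec_dom chart) chart_dom \<Theta>"
proof -
  define F where "F z = Complex (chart_x (fst (snd z)) (snd (snd z)) (fst z))
    (chart_y (fst (snd z)) (snd (snd z)) (fst z))" for z :: "real \<times> real \<times> real"
  have "continuous_on (UNIV \<times> chart_dom) F"
    unfolding F_def Complex_eq chart_x_def chart_y_def mult_re_def mult_im_def coef_L_def coef_K_def
      chart_w_def chart_M_def
    by (auto intro!: continuous_intros dest: chart_dom_nonzero)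
  moreover have "convex (UNIV \<times> chart_dom)"
    unfolding chart_dom_def by (intro convex_Times) auto
  moreover have "F z \<noteq> 0" if "z \<in> UNIV \<times> chart_dom" for z
    using chart_radius_sq_pos[of "fst (snd z)" "snd (snd z)" "fst z"] that
    by (auto simp: F_def complex_eq_iff)
  ultimately obtain g where g: "continuous_on (UNIV \<times> chart_dom) g"
    "\<And>z. z \<in> UNIV \<times> chart_dom \<Longrightarrow> F z = exp (g z)"
    using continuous_logarithm_on_contractible[OF _ convex_imp_contractible] by metis
  define \<Theta> where "\<Theta> t a b = Im (g (t, a, b))" for t a b
  have "angle_lift (x0, y0, z0) (inv_into covec_dom chart) chart_dom \<Theta>"
    unfolding angle_lift_def
  proof (intro conjI allI ballI)
    show "continuous_on (UNIV \<times> chart_dom) (\<lambda>(t, p). \<Theta> t (fst p) (snd p))"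
      using g(1) by (simp add: \<Theta>_def case_prod_beta continuous_intros)
  next
    fix t :: real and p
    assume p: "p \<in> chart_dom"
    obtain a b where ab: "p = (a, b)"
      by (cases p)
    have e: "Complex (chart_x a b t) (chart_y a b t) = exp (g (t, a, b))"
      using g(2)[of "(t, a, b)"] p by (simp add: F_def ab)
    then have "sqrt ((chart_x a b t)^2 + (chart_y a b t)^2) = exp (Re (g (t, a, b)))"
      by (metis complex_norm norm_exp_eq_Re)
    with e show "case normal_traj (x0, y0, z0) (inv_into covec_dom chart p) t of (x, y, z) \<Rightarrow>
        x = cyl_r (normal_traj (x0, y0, z0) (inv_into covec_dom chart p) t) * cos (\<Theta> t (fst p) (snd p)) \<and>
        y = cyl_r (normal_traj (x0, y0, z0) (inv_into covec_dom chart p) t) * sin (\<Theta> t (fst p) (snd p))"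
      using p normal_traj_chart_inv[of a b t] radius_chart_inv[of a b t]
      by (auto simp: ab inv_into_chart \<Theta>_def case_prod_beta complex_eq_iff Re_exp Im_exp)
  qed
  then show ?thesis
    by blast
qed

lemma angle_lift_polar:
  assumes \<Theta>: "angle_lift (x0, y0, z0) (inv_into covec_dom chart) chart_dom \<Theta>"
    and ab: "(a, b) \<in> chart_dom"
  shows "chart_x a b t = sqrt ((chart_x a b t)^2 + (chart_y a b t)^2) * cos (\<Theta> t a b)
    \<and> chart_y a b t = sqrt ((chart_x a b t)^2 + (chart_y a b t)^2) * sin (\<Theta> t a b)"
  using \<Theta> ab normal_traj_chart_inv[OF ab, of t] radius_chart_inv[OF ab, of t]
  unfolding angle_lift_def by (auto simp: inv_into_chart case_prod_beta)

lemma chart_dom_slices: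
  assumes "(a, b) \<in> chart_dom"
  shows "open {0<..<sqrt r0sq}" "a \<in> {0<..<sqrt r0sq}" "\<And>a'. a' \<in> {0<..<sqrt r0sq} \<Longrightarrow> (a', b) \<in> chart_dom"
    and "open {sqrt r0sq<..}" "b \<in> {sqrt r0sq<..}" "\<And>b'. b' \<in> {sqrt r0sq<..} \<Longrightarrow> (a, b') \<in> chart_dom"
  using assms by (auto simp: chart_dom_def)

lemma radius_partial_derivatives:
  fixes t :: real
  assumes ab: "(a, b) \<in> chart_dom"
  defines "R \<equiv> radius (inv_into covec_dom chart (a, b)) t"
  shows "((\<lambda>a'. radius (inv_into covec_dom chart (a', b)) t) has_real_derivative
      (chart_x a b t * chart_x' a b t (1, 0) + chart_y a b t * chart_y' a b t (1, 0)) / R) (at a)"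
    and "((\<lambda>b'. radius (inv_into covec_dom chart (a, b')) t) has_real_derivative
      (chart_x a b t * chart_x' a b t (0, 1) + chart_y a b t * chart_y' a b t (0, 1)) / R) (at b)"
proof -
  have radius_eq: "radius (inv_into covec_dom chart p) t
      = sqrt ((chart_x (fst p) (snd p) t)^2 + (chart_y (fst p) (snd p) t)^2)" if "p \<in> chart_dom" for p
    using that radius_chart_inv[of "fst p" "snd p" t] by (simp add: inv_into_chart)
  note d = chart_xy_partial_derivatives[OF ab, of t]
  note slices = chart_dom_slices[OF ab]
  show "((\<lambda>a'. radius (inv_into covec_dom chart (a', b)) t) has_real_derivative
      (chart_x a b t * chart_x' a b t (1, 0) + chart_y a b t * chart_y' a b t (1, 0)) / R) (at a)"
    unfolding R_def radius_eq[OF ab, simplified]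
    using has_real_derivative_sqrt_sum_squares[OF d(1,3) chart_radius_sq_pos[OF ab]]
    by (rule has_field_derivative_transform_within_open[OF _ slices(1,2)]) (simp add: radius_eq[OF slices(3)])
  show "((\<lambda>b'. radius (inv_into covec_dom chart (a, b')) t) has_real_derivative
      (chart_x a b t * chart_x' a b t (0, 1) + chart_y a b t * chart_y' a b t (0, 1)) / R) (at b)"
    unfolding R_def radius_eq[OF ab, simplified]
    using has_real_derivative_sqrt_sum_squares[OF d(2,4) chart_radius_sq_pos[OF ab]]
    by (rule has_field_derivative_transform_within_open[OF _ slices(4,5)]) (simp add: radius_eq[OF slices(6)])
qed

lemma angle_lift_partial_derivatives:
  assumes \<Theta>: "angle_lift (x0, y0, z0) (inv_into covec_dom chart) chart_dom \<Theta>"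
    and ab: "(a, b) \<in> chart_dom"
  shows "((\<lambda>a'. \<Theta> t a' b) has_real_derivative
      (chart_x a b t * chart_y' a b t (1, 0) - chart_y a b t * chart_x' a b t (1, 0))
        / ((chart_x a b t)^2 + (chart_y a b t)^2)) (at a)"
    and "((\<lambda>b'. \<Theta> t a b') has_real_derivative
      (chart_x a b t * chart_y' a b t (0, 1) - chart_y a b t * chart_x' a b t (0, 1))
        / ((chart_x a b t)^2 + (chart_y a b t)^2)) (at b)"
proof -
  have cont: "continuous_on (UNIV \<times> chart_dom) (\<lambda>(t, p). \<Theta> t (fst p) (snd p))"
    using \<Theta> unfolding angle_lift_def by blast
  note d = chart_xy_partial_derivatives[OF ab, of t]
  note slices = chart_dom_slices[OF ab]
  have "continuous_on {0<..<sqrt r0sq} (\<lambda>a'. \<Theta> t a' b)"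
    by (rule continuous_on_compose2[OF cont, where f = "\<lambda>a'. (t, a', b)", simplified])
      (auto intro!: continuous_intros slices(3))
  then show "((\<lambda>a'. \<Theta> t a' b) has_real_derivative
      (chart_x a b t * chart_y' a b t (1, 0) - chart_y a b t * chart_x' a b t (1, 0))
        / ((chart_x a b t)^2 + (chart_y a b t)^2)) (at a)"
    by (rule continuous_angle_has_derivative[OF slices(1,2) _ _ _ d(1) d(3)])
      (use angle_lift_polar[OF \<Theta> slices(3)] chart_radius_sq_pos[OF slices(3)] in blast)+
  have "continuous_on {sqrt r0sq<..} (\<lambda>b'. \<Theta> t a b')"
    by (rule continuous_on_compose2[OF cont, where f = "\<lambda>b'. (t, a, b')", simplified])
      (auto intro!: continuous_intros slices(6))
  then show "((\<lambda>b'. \<Theta> t a b') has_real_derivative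
      (chart_x a b t * chart_y' a b t (0, 1) - chart_y a b t * chart_x' a b t (0, 1))
        / ((chart_x a b t)^2 + (chart_y a b t)^2)) (at b)"
    by (rule continuous_angle_has_derivative[OF slices(4,5) _ _ _ d(2) d(4)])
      (use angle_lift_polar[OF \<Theta> slices(6)] chart_radius_sq_pos[OF slices(6)] in blast)+
qed

lemma angle_lift_jacobian:
  assumes \<Theta>: "angle_lift (x0, y0, z0) (inv_into covec_dom chart) chart_dom \<Theta>"
    and ab: "(a, b) \<in> chart_dom"
  shows "\<exists>Ra Rb Ta Tb.
      ((\<lambda>a'. radius (inv_into covec_dom chart (a', b)) t) has_real_derivative Ra) (at a) \<and>
      ((\<lambda>b'. radius (inv_into covec_dom chart (a, b')) t) has_real_derivative Rb) (at b) \<and>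
      ((\<lambda>a'. \<Theta> t a' b) has_real_derivative Ta) (at a) \<and>
      ((\<lambda>b'. \<Theta> t a b') has_real_derivative Tb) (at b) \<and>
      Ra * Tb - Rb * Ta = Dexpr (sqrt r0sq) a b t (radius (inv_into covec_dom chart (a, b)) t)"
proof -
  define X Y Xa Ya Xb Yb where "X = chart_x a b t" and "Y = chart_y a b t"
    and "Xa = chart_x' a b t (1, 0)" and "Ya = chart_y' a b t (1, 0)"
    and "Xb = chart_x' a b t (0, 1)" and "Yb = chart_y' a b t (0, 1)"
  define R where "R = radius (inv_into covec_dom chart (a, b)) t"
  have R: "0 < R" "R^2 = X^2 + Y^2"
    using chart_radius_sq_pos[OF ab, of t]
    by (simp_all add: R_def X_def Y_def inv_into_chart[OF ab] radius_chart_inv[OF ab])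
  have "((X * Xa + Y * Ya) / R) * ((X * Yb - Y * Xb) / (X^2 + Y^2))
      - ((X * Xb + Y * Yb) / R) * ((X * Ya - Y * Xa) / (X^2 + Y^2)) = (Xa * Yb - Ya * Xb) / R"
    by (rule polar_jacobian_identity[OF R])
  also have "\<dots> = Dexpr (sqrt r0sq) a b t R"
    unfolding Xa_def Ya_def Xb_def Yb_def chart_jacobian_eq_jac_num[OF ab] Dexpr_eq_jac_num[OF ab] ..
  finally show ?thesis
    using radius_partial_derivatives[OF ab, of t] angle_lift_partial_derivatives[OF \<Theta> ab, of t]
    unfolding X_def Y_def Xa_def Ya_def Xb_def Yb_def R_def by blast
qed

subsection \<open>Conjugate time\<close>

definition osc_z_dw :: "real \<Rightarrow> real \<Rightarrow> real \<Rightarrow> real" where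
  "osc_z_dw u v w = r0sq * (1 + (cos w)^2 - (sin w)^2) / 2
     + (u^2 + v^2) * (w * (1 - (cos w)^2 + (sin w)^2) - 2 * (w - sin w * cos w)) / (2 * w^3)
     + (x0 * u + y0 * v) * (2 * w * sin w * cos w - (sin w)^2) / w^2"

definition Exp_diff :: "real \<times> real \<times> real \<Rightarrow> real \<times> real \<times> real \<Rightarrow> real \<times> real \<times> real" where
  "Exp_diff l h = (case l of (u, v, w) \<Rightarrow>
     (sinc w * fst h + osc_dw x0 u w * snd (snd h),
      sinc w * fst (snd h) + osc_dw y0 v w * snd (snd h),
      osc_z_dp x0 u w * fst h + osc_z_dp y0 v w * fst (snd h) + osc_z_dw u v w * snd (snd h)))"

lemma Exp_has_derivative:
  assumes "0 < snd (snd l)"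
  shows "(Exp (x0, y0, z0) has_derivative Exp_diff l) (at l)"
proof -
  define E where "E l = (osc x0 (fst l) (snd (snd l)) 1, osc y0 (fst (snd l)) (snd (snd l)) 1,
    osc_z (fst l) (fst (snd l)) (snd (snd l)) 1)" for l :: "real \<times> real \<times> real"
  obtain u v w where l: "l = (u, v, w)" and w: "w \<noteq> 0"
    using assms by (cases l) auto
  have deriv: "(E has_derivative Exp_diff (u, v, w)) (at (u, v, w))"
    unfolding E_def[abs_def] osc_def osc_z_def using w
    apply (auto intro!: derivative_eq_intros)
    apply (rule ext)
    apply (simp add: Exp_diff_def sinc_def osc_dw_def osc_z_dp_def osc_z_dw_def)
    apply (simp add: field_simps power2_eq_square power3_eq_cube power4_eq_xxxx)
    done
  have "open {l :: real \<times> real \<times> real. 0 < snd (snd l)}"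
    by (intro open_Collect_less continuous_intros)
  then show ?thesis
    unfolding l
  proof (rule has_derivative_transform_within_open[OF deriv])
    show "(u, v, w) \<in> {l. 0 < snd (snd l)}"
      using assms l by simp
    show "E l' = Exp (x0, y0, z0) l'" if "l' \<in> {l. 0 < snd (snd l)}" for l'
      using that by (simp add: E_def Exp_def normal_traj_eq_osc_traj osc_traj_def case_prod_beta)
  qed
qed

lemma exp_critical_iff:
  "0 < snd (snd l) \<Longrightarrow> exp_critical (x0, y0, z0) l \<longleftrightarrow> \<not> surj (Exp_diff l)"
  using Exp_has_derivative has_derivative_unique unfolding exp_critical_def by metis

lemma Exp_diff_det:
  assumes "w \<noteq> 0"
  shows "sinc w * osc_z_dw u v w - osc_dw x0 u w * osc_z_dp x0 u w - osc_dw y0 v w * osc_z_dp y0 v w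
    = (r0sq + x0 * u + y0 * v) * sin w / w + (u^2 + v^2) * (sin w - w * cos w) / w^3"
  unfolding sinc_def osc_z_dw_def osc_dw_def osc_z_dp_def
  by (rule Exp_jacobian_identity[OF assms sin_cos_squared_add r0sq_def])

text \<open>Cramer's rule for the matrix \<open>[[s, 0, X], [0, s, Y], [U, V, Z]]\<close> of \<open>Exp_diff\<close>,
  whose determinant is \<open>s (s Z - X U - Y V)\<close>.\<close>
lemma surj_Exp_diff:
  assumes s: "sinc w \<noteq> 0"
    and det: "sinc w * osc_z_dw u v w - osc_dw x0 u w * osc_z_dp x0 u w - osc_dw y0 v w * osc_z_dp y0 v w \<noteq> 0"
  shows "surj (Exp_diff (u, v, w))"
proof (rule surjI)
  fix y :: "real \<times> real \<times> real"
  define D where "D = sinc w * osc_z_dw u v w - osc_dw x0 u w * osc_z_dp x0 u w - osc_dw y0 v w * osc_z_dp y0 v w"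
  define h3 where "h3 = (sinc w * snd (snd y) - osc_z_dp x0 u w * fst y - osc_z_dp y0 v w * fst (snd y)) / D"
  define h1 h2 where "h1 = (fst y - osc_dw x0 u w * h3) / sinc w"
    and "h2 = (fst (snd y) - osc_dw y0 v w * h3) / sinc w"
  have "osc_z_dp x0 u w * h1 + osc_z_dp y0 v w * h2 + osc_z_dw u v w * h3
      = (osc_z_dp x0 u w * fst y + osc_z_dp y0 v w * fst (snd y) + h3 * D) / sinc w"
    using s unfolding h1_def h2_def D_def by (simp add: field_simps)
  also have "h3 * D = sinc w * snd (snd y) - osc_z_dp x0 u w * fst y - osc_z_dp y0 v w * fst (snd y)"
    using det by (simp add: h3_def D_def)
  finally show "Exp_diff (u, v, w) (h1, h2, h3) = y"
    using s by (simp add: Exp_diff_def h1_def h2_def prod_eq_iff)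
qed

lemma not_surj_Exp_diff:
  assumes "sinc w = 0"
  shows "\<not> surj (Exp_diff (u, v, w))"
proof
  assume su: "surj (Exp_diff (u, v, w))"
  show False
  proof (cases "osc_dw y0 v w = 0")
    case True
    obtain h where "Exp_diff (u, v, w) h = (0, 1, 0)"
      using su by (metis surjD)
    with True assms show False
      by (simp add: Exp_diff_def)
  next
    case False
    obtain h where "Exp_diff (u, v, w) h = (1, 0, 0)"
      using su by (metis surjD)
    then have "osc_dw y0 v w * snd (snd h) = 0" "osc_dw x0 u w * snd (snd h) = 1"
      using assms by (simp_all add: Exp_diff_def)
    with False show False
      by simp
  qed
qed

lemma t_con_eq:
  assumes w: "0 < w" and L: "0 < x0 * u + y0 * v"
  shows "t_con (x0, y0, z0) (u, v, w) = pi / w"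
proof -
  have crit: "exp_critical (x0, y0, z0) (t *\<^sub>R (u, v, w)) \<longleftrightarrow> \<not> surj (Exp_diff (t * u, t * v, t * w))"
    if "0 < t" for t
    using exp_critical_iff[of "(t * u, t * v, t * w)"] that w by simp
  have "\<not> surj (Exp_diff (pi / w * u, pi / w * v, pi / w * w))"
    using w by (intro not_surj_Exp_diff) (simp add: sinc_def)
  then have first: "pi / w \<in> {t. 0 < t \<and> exp_critical (x0, y0, z0) (t *\<^sub>R (u, v, w))}"
    using crit[of "pi / w"] w by simp
  have "\<not> exp_critical (x0, y0, z0) (t *\<^sub>R (u, v, w))" if t: "0 < t" "t < pi / w" for t
  proof -
    define x where "x = t * w"
    have x: "0 < x" "x < pi"
      using t w by (simp_all add: x_def field_simps)
    then have "0 < sin x"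
      by (intro sin_gt_zero) auto
    then have "0 < sinc x"
      using x by (simp add: sinc_def)
    have "r0sq + x0 * (t * u) + y0 * (t * v) = r0sq + t * (x0 * u + y0 * v)"
      by (simp add: algebra_simps)
    also have "0 < \<dots>"
      using t L r0sq_pos by (simp add: add_pos_pos)
    finally have "0 < (r0sq + x0 * (t * u) + y0 * (t * v)) * sin x / x"
      using \<open>0 < sin x\<close> x by simp
    moreover have "0 \<le> ((t * u)^2 + (t * v)^2) * (sin x - x * cos x) / x^3"
      using x_cos_less_sin[of x] x by (intro divide_nonneg_pos mult_nonneg_nonneg) simp_all
    ultimately have "sinc x * osc_z_dw (t * u) (t * v) x - osc_dw x0 (t * u) x * osc_z_dp x0 (t * u) x
        - osc_dw y0 (t * v) x * osc_z_dp y0 (t * v) x \<noteq> 0"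
      unfolding Exp_diff_det[of x "t * u" "t * v", OF less_imp_neq[OF x(1), symmetric]] by linarith
    with \<open>0 < sinc x\<close> have "surj (Exp_diff (t * u, t * v, x))"
      by (intro surj_Exp_diff) auto
    then show ?thesis
      using crit[OF t(1)] by (simp add: x_def)
  qed
  then have "pi / w \<le> t" if "t \<in> {t. 0 < t \<and> exp_critical (x0, y0, z0) (t *\<^sub>R (u, v, w))}" for t
    using that by force
  then show ?thesis
    unfolding t_con_def by (rule cInf_eq_minimum[OF first])
qed

lemma trajectory_in_chart_coordinates:
  assumes l: "l \<in> covec_dom"
  shows "let a = rmin (x0, y0, z0) l; b = rmax (x0, y0, z0) l; w0 = wof l; \<phi> = phase (sqrt r0sq) a b;
      r = (\<lambda>t. cyl_r (normal_traj (x0, y0, z0) l t)) in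
    0 < a \<and> a < sqrt r0sq \<and> sqrt r0sq < b \<and>
    w0 = 1 / sqrt (a^2 + b^2) \<and> Kof (x0, y0, z0) l = a * b / sqrt (a^2 + b^2) \<and>
    (\<forall>T. \<exists>t>T. r t = a) \<and> (\<forall>T. \<exists>t>T. r t = b) \<and>
    0 < \<phi> \<and> \<phi> < pi / 2 \<and> (sqrt r0sq)^2 = a^2 + (b^2 - a^2) * (sin \<phi>)^2 \<and>
    (\<forall>t. (r t)^2 = a^2 + (b^2 - a^2) * (sin (w0 * t + \<phi>))^2) \<and>
    t_con (x0, y0, z0) l = pi / w0"
proof -
  obtain a b where ab_eq: "chart l = (a, b)"
    by (cases "chart l")
  have ab: "(a, b) \<in> chart_dom" and l_eq: "l = chart_inv (a, b)"
    using chart_in_chart_dom[OF l] chart_inv_chart[OF l] ab_eq by simp_all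
  obtain u v w where uvw: "l = (u, v, w)"
    by (cases l)
  have "t_con (x0, y0, z0) l = pi / wof l"
    using l by (simp add: uvw mem_covec_dom_iff t_con_eq wof_def)
  moreover have "a < sqrt r0sq" "sqrt r0sq < b"
    using ab by (simp_all add: chart_dom_def)
  moreover have "wof l = chart_w a b" "Kof (x0, y0, z0) l = a * b / sqrt (a^2 + b^2)"
    unfolding l_eq wof_chart_inv Kof_chart_inv by (simp_all add: chart_K_def chart_w_def)
  ultimately show ?thesis
    unfolding Let_def l_eq rmin_chart_inv[OF ab] rmax_chart_inv[OF ab] phase_eq_phase_angle[OF ab]
    using chart_domD[OF ab] phase_angle_props[OF ab] radius_chart_inv_recurrent[OF ab]
      radius_chart_inv_sq[OF ab] r0sq_pos
    by (auto simp: l_eq chart_w_def)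
qed

end

theorem lemma11:
  fixes x0 y0 z0 :: real
  assumes "x0^2 + y0^2 > 0"
  defines "q0 \<equiv> (x0, y0, z0)"
      and "r0 \<equiv> sqrt (x0^2 + y0^2)"
      and "S \<equiv> {l \<in> E1 (x0, y0, z0). Kof (x0, y0, z0) l > 0 \<and> Lof (x0, y0, z0) l > 0 \<and> wof l > 0}"
      and "A \<equiv> {0<..<sqrt (x0^2 + y0^2)} \<times> {sqrt (x0^2 + y0^2)<..}"
      and "\<Phi> \<equiv> (\<lambda>l. (rmin (x0, y0, z0) l, rmax (x0, y0, z0) l))"
  shows
    "(\<forall>l\<in>S. let a = rmin q0 l; b = rmax q0 l; w0 = wof l; \<phi> = phase r0 a b;
              r = (\<lambda>t. cyl_r (normal_traj q0 l t)) in
        0 < a \<and> a < r0 \<and> r0 < b \<and>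
        w0 = 1 / sqrt (a^2 + b^2) \<and> Kof q0 l = a * b / sqrt (a^2 + b^2) \<and>
        (\<forall>T. \<exists>t>T. r t = a) \<and> (\<forall>T. \<exists>t>T. r t = b) \<and>
        0 < \<phi> \<and> \<phi> < pi / 2 \<and> r0^2 = a^2 + (b^2 - a^2) * (sin \<phi>)^2 \<and>
        (\<forall>t. (r t)^2 = a^2 + (b^2 - a^2) * (sin (w0 * t + \<phi>))^2) \<and>
        t_con q0 l = pi / w0)
     \<and> bij_betw \<Phi> S A
     \<and> continuous_on S \<Phi>
     \<and> (\<exists>\<Psi>'. (\<forall>p\<in>A. (inv_into S \<Phi> has_derivative \<Psi>' p) (at p) \<and> inj (\<Psi>' p))
             \<and> continuous_on A (\<lambda>p. \<Psi>' p (1, 0)) \<and> continuous_on A (\<lambda>p. \<Psi>' p (0, 1)))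
     \<and> (\<exists>\<Theta>. angle_lift q0 (inv_into S \<Phi>) A \<Theta>)
     \<and> (\<forall>\<Theta>. angle_lift q0 (inv_into S \<Phi>) A \<Theta> \<longrightarrow>
          (\<forall>a b t. (a, b) \<in> A \<longrightarrow>
             (let R = (\<lambda>a' b'. cyl_r (normal_traj q0 (inv_into S \<Phi> (a', b')) t)) in
              \<exists>Ra Rb Ta Tb.
                ((\<lambda>a'. R a' b) has_real_derivative Ra) (at a) \<and>
                ((\<lambda>b'. R a b') has_real_derivative Rb) (at b) \<and>
                ((\<lambda>a'. \<Theta> t a' b) has_real_derivative Ta) (at a) \<and>
                ((\<lambda>b'. \<Theta> t a b') has_real_derivative Tb) (at b) \<and>
                Ra * Tb - Rb * Ta = Dexpr r0 a b t (R a b))))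
     \<and> (\<forall>a b. (a, b) \<in> A \<longrightarrow>
          (let w0 = 1 / sqrt (a^2 + b^2);
               D = (\<lambda>t. Dexpr r0 a b t (cyl_r (normal_traj q0 (inv_into S \<Phi> (a, b)) t))) in
           D (pi / w0) = 0 \<and> (\<forall>t. 0 < t \<and> t < pi / w0 \<longrightarrow> D t \<noteq> 0)))"
proof -
  interpret off_axis_point x0 y0 z0
    using assms(1) by unfold_locales
  have "S = covec_dom" "A = chart_dom" "\<Phi> = chart" "r0 = sqrt r0sq"
    unfolding S_def covec_dom_def A_def chart_dom_def \<Phi>_def chart_def[abs_def] r0_def r0sq_def
    by simp_all
  then show ?thesis
    unfolding q0_def Let_def
    using trajectory_in_chart_coordinates[unfolded Let_def] bij_betw_chart continuous_on_chart
      chart_inv_differentiable angle_lift_exists angle_lift_jacobian Dexpr_first_zero[unfolded Let_def]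
    by simp
qed

end
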